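(* Consider the mixed-integer nonlinear program (MINLP) $\min_{x\in X,\,y\in Y} f(x,y)$ subject to $g(x,y)\le 0$, $h(x,y)=0$, and suppose that: (1) $Y=\bar Y\cap\mathbb{Z}^{n_y}$, where $X\subset\mathbb{R}^{n_x}$ and $\bar Y\subset\mathbb{R}^{n_y}$ are closed convex polyhedral sets; $f:\mathbb{R}^{n_x}\times\mathbb{R}^{n_y}\to\mathbb{R}$, $g:\mathbb{R}^{n_x}\times\mathbb{R}^{n_y}\to\mathbb{R}^{n_g}$, $h:\mathbb{R}^{n_x}\times\mathbb{R}^{n_y}\to\mathbb{R}^{n_h}$ are at least twice continuously differentiable; and $Y$ is finite; (2) for all $y\in Y$, the Mangasarian-Fromovitz constraint qualification holds at the solution $x^\star$ of the problem $\mathrm{NLP}(y)$: $\min_{x\in X} f(x,y)$ s.t. $g(x,y)\le0$, $h(x,y)=0$; (3) $h$ is affine, and $g_1,\dots,g_{n_g}$ and $f$ are convex on $X\times\bar Y$. Then the S-B-MIQP algorithm (described in the context) terminates in a finite number of iterations and returns either a global optimal solution of the MINLP or a certificate of infeasibility.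
   Context: Notation. For a vector-valued $\phi$, $\nabla\phi$ is the transpose of the Jacobian. $\phi_{\mathrm L}(x,y;\bar x,\bar y)=\phi(\bar x,\bar y)+\nabla\phi(\bar x,\bar y)^\top\binom{x-\bar x}{y-\bar y}$ is the linearization of $\phi$ at $(\bar x,\bar y)$. Value function. $J(y)=\min_{x\in X}\{f(x,y): g(x,y)\le0,\ h(x,y)=0\}$ is the optimal value of $\mathrm{NLP}(y)$, with $J(y)=+\infty$ if $\mathrm{NLP}(y)$ is infeasible. For $\tilde y\in Y$, consider the lifted problem $\min_{x\in X,\,y\in Y} f(x,y)$ s.t. $g(x,y)\le0$, $h(x,y)=0$, $y-\tilde y=0$, with locally optimal solution $(x^\star,\tilde y)$ and Lagrange multipliers $\lambda,\mu,\mu_{\tilde y}$ of the three groups of constraints respectively; the KKT conditions are written as $\nabla_x f+\nabla_x g\,\lambda+\nabla_x h\,\mu=0$, $\nabla_y f+\nabla_y g\,\lambda+\nabla_y h\,\mu=-\mu_{\tilde y}$, $g\le0$, $h=0$, $\lambda\ge0$, $\lambda_i g_i=0$ for $i=1,\dots,n_g$, all evaluated at $(x^\star,\tilde y)$. One sets $\nabla J(\tilde y):=-\mu_{\tilde y}$. Feasibility problem $\mathrm{FNLP}(\hat y,y_b)$: $\min_{x\in X,\,y\in\bar Y}\|y-\hat y\|_2^2$ s.t. $g(x,y)\le0$, $h(x,y)=0$ and, only if a feasible best point $y_b$ is available, $\|y_b-y\|_2^2\le\|y_b-\hat y\|_2^2$. The $y$-component of its solution is denoted $\bar y$. Bookkeeping.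 $y_k\in Y$ is the integer point processed at iteration $k$. $\mathbb{T}_k$ (resp. $\mathbb{S}_k$) is the set of indices $i\le k$ for which $\mathrm{NLP}(y_i)$ is feasible (resp. infeasible). For $i\in\mathbb{T}_k$, $x_i$ is the solution of $\mathrm{NLP}(y_i)$; for $i\in\mathbb{S}_k$, $(x_i,\bar y_i)$ is the solution of the feasibility problem. The best index is $b(k)\in\arg\min_{i\in\mathbb{T}_k}J(y_i)$ if $\mathbb{T}_k\ne\emptyset$, and $b(k)\in\arg\min_{i\in\mathbb{S}_k}\|\bar y_i-y_i\|_2^2$ otherwise; ties are broken by the smallest index. Let $\alpha\in[0,1)$ be a user-chosen parameter and $\bar J_k=\alpha J(y_{b(k)})+(1-\alpha)\mathrm{LB}$ with the current lower bound $\mathrm{LB}$. Master problem BR-MIQP at iteration $k$ (with $b=b(k)$ and $B_b$ a symmetric positive semidefinite approximation of the Hessian, with respect to $(x,y)$, of the Lagrangian of the NLP at $(x_b,y_b)$): minimize over $x\in X$, $y\in Y$ the function $f_{\mathrm L}(x,y;x_b,y_b)+\frac12\binom{x-x_b}{y-y_b}^\top B_b\binom{x-x_b}{y-y_b}$ subject to $g_{\mathrm L}(x,y;x_b,y_b)\le0$, $h_{\mathrm L}(x,y;x_b,y_b)=0$, $J(y_i)+\nabla J(y_i)^\top(y-y_i)\le\bar J_k$ for $i\in\mathbb{T}_k$, and $(y_i-\bar y_i)^\top(y-\bar y_i)\le0$ for $i\in\mathbb{S}_k$. Master problem LB-MILP at iteration $k$: minimize $\eta$ over $\eta\in\mathbb{R}$,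 $x\in X$, $y\in Y$ subject to (only if $b\in\mathbb{T}_k$) $\eta\ge f_{\mathrm L}(x,y;x_b,y_b)$, $0\ge g_{\mathrm L}(x,y;x_b,y_b)$, $0=h_{\mathrm L}(x,y;x_b,y_b)$; $\eta\ge J(y_i)+\nabla J(y_i)^\top(y-y_i)$ for $i\in\mathbb{T}_k\setminus\{b\}$; and $0\ge(y_i-\bar y_i)^\top(y-\bar y_i)$ for $i\in\mathbb{S}_k$. Its objective value at a solution is $V_{\mathrm{MILP}}$. S-B-MIQP algorithm. Initialize with $y_0\in Y$, $k=0$, $b(0)=0$, $\mathbb{S}_{-1}=\mathbb{T}_{-1}=\emptyset$, $\mathrm{UB}=+\infty$, $\mathrm{LB}=\min_{y\in\bar Y}J(y)$ (the objective of the continuous relaxation of the MINLP). While $\mathrm{LB}<\mathrm{UB}$: (i) Solve $\mathrm{NLP}(y_k)$. If feasible, store $(k,x_k,y_k,J(y_k),\nabla J(y_k))$, set $\mathbb{T}_k=\mathbb{T}_{k-1}\cup\{k\}$, $\mathbb{S}_k=\mathbb{S}_{k-1}$, and if $J(y_k)<\mathrm{UB}$ set $\mathrm{UB}=J(y_k)$. If infeasible, solve $\mathrm{FNLP}(y_k,y_b)$ with the current feasible best point $y_b$ (if any), store its solution with $\bar y_k$, set $\mathbb{S}_k=\mathbb{S}_{k-1}\cup\{k\}$, $\mathbb{T}_k=\mathbb{T}_{k-1}$. (ii) Compute $b(k)$. (iii) If $k-b(k)\le1$, solve BR-MIQP and, if feasible, let $\tilde y$ be the $y$-component of its solution. (iv)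 If $k-b(k)>1$ or BR-MIQP is infeasible, solve LB-MILP. If it is infeasible, set $\mathrm{LB}=+\infty$. Otherwise let $\tilde y$ be the $y$-component of its solution, and if $V_{\mathrm{MILP}}>\mathrm{LB}$ set $\mathrm{LB}=V_{\mathrm{MILP}}$. (v) Set $y_{k+1}=\tilde y$, $b(k+1)=b(k)$, $k\leftarrow k+1$. The solution returned is the incumbent $(x_b,y_b)$, i.e. the best feasible point found, with objective $\mathrm{UB}$. The certificate of infeasibility is termination with $\mathrm{LB}=\mathrm{UB}=+\infty$, by which the MINLP is classified as infeasible.
   Formalization: FNLP, and a feasible BR-MIQP while no feasible point is known, are assumed to have solutions (FNLP fails for X=R, Ȳ=[0,1], g=e^{-x}-y, f=x², y_0=0); MFCQ directions must point into X, KKT stationarity holds only along X; LB-MILP with T_k empty has V=-∞. *)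

theory Defs
  imports "HOL-Analysis.Analysis"
begin

subsection \<open>Gradients, linearization, smoothness\<close>

definition grad :: "('a::real_inner \<Rightarrow> real) \<Rightarrow> 'a \<Rightarrow> 'a" where
  "grad \<phi> z = (THE D. GDERIV \<phi> z :> D)"

abbreviation grad_x :: "('a::real_inner \<times> 'b::real_inner \<Rightarrow> real) \<Rightarrow> 'a \<times> 'b \<Rightarrow> 'a" where
  "grad_x \<phi> z \<equiv> fst (grad \<phi> z)"

abbreviation grad_y :: "('a::real_inner \<times> 'b::real_inner \<Rightarrow> real) \<Rightarrow> 'a \<times> 'b \<Rightarrow> 'b" where
  "grad_y \<phi> z \<equiv> snd (grad \<phi> z)"

definition linz :: "('a::real_inner \<Rightarrow> real) \<Rightarrow> 'a \<Rightarrow> 'a \<Rightarrow> real" where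
  "linz \<phi> zb z = \<phi> zb + grad \<phi> zb \<bullet> (z - zb)"

definition twice_cont_differentiable :: "('a::euclidean_space \<Rightarrow> real) \<Rightarrow> bool" where
  "twice_cont_differentiable \<phi> \<longleftrightarrow>
     (\<exists>(\<phi>' :: 'a \<Rightarrow> 'a \<Rightarrow>\<^sub>L real) (\<phi>'' :: 'a \<Rightarrow> 'a \<Rightarrow>\<^sub>L 'a \<Rightarrow>\<^sub>L real).
        (\<forall>z. (\<phi> has_derivative blinfun_apply (\<phi>' z)) (at z)) \<and>
        (\<forall>z. (\<phi>' has_derivative blinfun_apply (\<phi>'' z)) (at z)) \<and>
        continuous_on UNIV \<phi>'')"

definition affine_fun :: "('a::real_inner \<Rightarrow> real) \<Rightarrow> bool" where
  "affine_fun \<phi> \<longleftrightarrow> (\<exists>a c. \<forall>z. \<phi> z = a \<bullet> z + c)"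

definition sym_psd :: "('a::real_inner \<Rightarrow> 'a) \<Rightarrow> bool" where
  "sym_psd M \<longleftrightarrow> linear M \<and> (\<forall>u v. M u \<bullet> v = u \<bullet> M v) \<and> (\<forall>u. 0 \<le> u \<bullet> M u)"

subsection \<open>The MINLP and its subproblems\<close>

text \<open>The components of the vector-valued constraint functions are \<open>con_g P i\<close> for \<open>i < n_g P\<close>
  and \<open>con_h P j\<close> for \<open>j < n_h P\<close>; indexing by naturals (rather than by a type) admits problems
  without inequality or without equality constraints.\<close>

record ('nx, 'ny) minlp =
  X_set :: "(real ^ 'nx) set"
  Y_bar :: "(real ^ 'ny) set"
  obj :: "(real ^ 'nx) \<times> (real ^ 'ny) \<Rightarrow> real"
  n_g :: nat
  con_g :: "nat \<Rightarrow> (real ^ 'nx) \<times> (real ^ 'ny) \<Rightarrow> real"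
  n_h :: nat
  con_h :: "nat \<Rightarrow> (real ^ 'nx) \<times> (real ^ 'ny) \<Rightarrow> real"

definition Y_int :: "('nx::finite, 'ny::finite) minlp \<Rightarrow> (real ^ 'ny) set" where
  "Y_int P = Y_bar P \<inter> {y. \<forall>i. y $ i \<in> \<int>}"

definition constraints_ok ::
    "('nx::finite, 'ny::finite) minlp \<Rightarrow> (real ^ 'nx) \<times> (real ^ 'ny) \<Rightarrow> bool" where
  "constraints_ok P z \<longleftrightarrow> (\<forall>i<n_g P. con_g P i z \<le> 0) \<and> (\<forall>j<n_h P. con_h P j z = 0)"

definition minlp_feas ::
    "('nx::finite, 'ny::finite) minlp \<Rightarrow> ((real ^ 'nx) \<times> (real ^ 'ny)) set" where
  "minlp_feas P = {(x, y). x \<in> X_set P \<and> y \<in> Y_int P \<and> constraints_ok P (x, y)}"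

definition minlp_opt ::
    "('nx::finite, 'ny::finite) minlp \<Rightarrow> (real ^ 'nx) \<times> (real ^ 'ny) \<Rightarrow> bool" where
  "minlp_opt P z \<longleftrightarrow> is_arg_min (obj P) (\<lambda>z. z \<in> minlp_feas P) z"

definition nlp_feas ::
    "('nx::finite, 'ny::finite) minlp \<Rightarrow> real ^ 'ny \<Rightarrow> (real ^ 'nx) set" where
  "nlp_feas P y = {x \<in> X_set P. constraints_ok P (x, y)}"

definition nlp_opt ::
    "('nx::finite, 'ny::finite) minlp \<Rightarrow> real ^ 'ny \<Rightarrow> real ^ 'nx \<Rightarrow> bool" where
  "nlp_opt P y x \<longleftrightarrow> is_arg_min (\<lambda>x. obj P (x, y)) (\<lambda>x. x \<in> nlp_feas P y) x"

text \<open>The infimum over the empty set is \<open>\<infinity>\<close>, as required for infeasible \<open>y\<close>.\<close>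

definition J :: "('nx::finite, 'ny::finite) minlp \<Rightarrow> real ^ 'ny \<Rightarrow> ereal" where
  "J P y = (INF x\<in>nlp_feas P y. ereal (obj P (x, y)))"

text \<open>The Mangasarian--Fromovitz condition and the KKT conditions at a point of the NLP, which
  carries the abstract constraint \<open>x \<in> X\<close>: the MFCQ direction \<open>x' - x\<close> must point into \<open>X\<close>, and
  stationarity is required along the directions pointing into \<open>X\<close>. If \<open>x\<close> is interior to \<open>X\<close>
  (e.g. \<open>X = UNIV\<close>), the direction in the former is arbitrary up to positive scaling,
  and the latter says that the \<open>x\<close>-gradient of the Lagrangian vanishes.\<close>

definition mfcq ::
    "('nx::finite, 'ny::finite) minlp \<Rightarrow> real ^ 'ny \<Rightarrow> real ^ 'nx \<Rightarrow> bool" where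
  "mfcq P y x \<longleftrightarrow>
     inj_on (\<lambda>j. grad_x (con_h P j) (x, y)) {..<n_h P} \<and>
     independent ((\<lambda>j. grad_x (con_h P j) (x, y)) ` {..<n_h P}) \<and>
     (\<exists>x'\<in>X_set P.
        (\<forall>j<n_h P. grad_x (con_h P j) (x, y) \<bullet> (x' - x) = 0) \<and>
        (\<forall>i<n_g P. con_g P i (x, y) = 0 \<longrightarrow> grad_x (con_g P i) (x, y) \<bullet> (x' - x) < 0))"

definition kkt ::
    "('nx::finite, 'ny::finite) minlp \<Rightarrow> real ^ 'ny \<Rightarrow> real ^ 'nx \<Rightarrow>
     (nat \<Rightarrow> real) \<Rightarrow> (nat \<Rightarrow> real) \<Rightarrow> real ^ 'ny \<Rightarrow> bool" where
  "kkt P y x lam mu mu_y \<longleftrightarrow>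
     x \<in> X_set P \<and> constraints_ok P (x, y) \<and>
     (\<forall>x'\<in>X_set P.
        0 \<le> (grad_x (obj P) (x, y)
             + (\<Sum>i<n_g P. lam i *\<^sub>R grad_x (con_g P i) (x, y))
             + (\<Sum>j<n_h P. mu j *\<^sub>R grad_x (con_h P j) (x, y))) \<bullet> (x' - x)) \<and>
     grad_y (obj P) (x, y)
       + (\<Sum>i<n_g P. lam i *\<^sub>R grad_y (con_g P i) (x, y))
       + (\<Sum>j<n_h P. mu j *\<^sub>R grad_y (con_h P j) (x, y)) = - mu_y \<and>
     (\<forall>i<n_g P. 0 \<le> lam i \<and> lam i * con_g P i (x, y) = 0)"

text \<open>Multipliers need not be unique, hence \<open>\<nabla>J\<close> is a relation: any choice is admitted.\<close>

definition is_gradJ ::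
    "('nx::finite, 'ny::finite) minlp \<Rightarrow> real ^ 'ny \<Rightarrow> real ^ 'nx \<Rightarrow> real ^ 'ny \<Rightarrow> bool" where
  "is_gradJ P y x v \<longleftrightarrow> (\<exists>lam mu mu_y. kkt P y x lam mu mu_y \<and> v = - mu_y)"

definition fnlp_feas ::
    "('nx::finite, 'ny::finite) minlp \<Rightarrow> real ^ 'ny \<Rightarrow> (real ^ 'ny) option \<Rightarrow>
     ((real ^ 'nx) \<times> (real ^ 'ny)) set" where
  "fnlp_feas P yh yb = {(x, y). x \<in> X_set P \<and> y \<in> Y_bar P \<and> constraints_ok P (x, y) \<and>
     (case yb of None \<Rightarrow> True | Some yb \<Rightarrow> (norm (yb - y))\<^sup>2 \<le> (norm (yb - yh))\<^sup>2)}"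

definition fnlp_opt ::
    "('nx::finite, 'ny::finite) minlp \<Rightarrow> real ^ 'ny \<Rightarrow> (real ^ 'ny) option \<Rightarrow>
     (real ^ 'nx) \<times> (real ^ 'ny) \<Rightarrow> bool" where
  "fnlp_opt P yh yb z \<longleftrightarrow>
     is_arg_min (\<lambda>(x, y). (norm (y - yh))\<^sup>2) (\<lambda>z. z \<in> fnlp_feas P yh yb) z"

subsection \<open>State of the algorithm\<close>

text \<open>\<open>gJ s i\<close> is the stored \<open>\<nabla>J(y\<^sub>i)\<close>, meaningful for \<open>i \<in> T_set s\<close>; \<open>ybar s i\<close> is
  meaningful for \<open>i \<in> S_set s\<close>. The values \<open>J(y\<^sub>i)\<close> need no storage.\<close>

record ('nx, 'ny) state =
  iter :: nat
  best :: nat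
  T_set :: "nat set"
  S_set :: "nat set"
  UB :: ereal
  LB :: ereal
  xpt :: "nat \<Rightarrow> real ^ 'nx"
  ypt :: "nat \<Rightarrow> real ^ 'ny"
  ybar :: "nat \<Rightarrow> real ^ 'ny"
  gJ :: "nat \<Rightarrow> real ^ 'ny"

abbreviation cur_y :: "('nx::finite, 'ny::finite) state \<Rightarrow> real ^ 'ny" where
  "cur_y s \<equiv> ypt s (iter s)"

definition incumbent :: "('nx::finite, 'ny::finite) state \<Rightarrow> (real ^ 'nx) \<times> (real ^ 'ny)" where
  "incumbent s = (xpt s (best s), ypt s (best s))"

definition feasible_best_y :: "('nx::finite, 'ny::finite) state \<Rightarrow> (real ^ 'ny) option" where
  "feasible_best_y s = (if T_set s = {} then None else Some (ypt s (best s)))"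

definition best_index ::
    "('nx::finite, 'ny::finite) minlp \<Rightarrow> ('nx, 'ny) state \<Rightarrow> nat" where
  "best_index P s =
     (if T_set s \<noteq> {}
      then (LEAST i. is_arg_min (\<lambda>i. J P (ypt s i)) (\<lambda>i. i \<in> T_set s) i)
      else (LEAST i. is_arg_min (\<lambda>i. (norm (ybar s i - ypt s i))\<^sup>2) (\<lambda>i. i \<in> S_set s) i))"

definition set_best ::
    "('nx::finite, 'ny::finite) minlp \<Rightarrow> ('nx, 'ny) state \<Rightarrow> ('nx, 'ny) state" where
  "set_best P s = s\<lparr>best := best_index P s\<rparr>"

definition initial_state ::
    "('nx::finite, 'ny::finite) minlp \<Rightarrow> ('nx, 'ny) state \<Rightarrow> bool" where
  "initial_state P s \<longleftrightarrow>
     iter s = 0 \<and> best s = 0 \<and> T_set s = {} \<and> S_set s = {} \<and> ypt s 0 \<in> Y_int P \<and>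
     UB s = \<infinity> \<and> LB s = (INF y\<in>Y_bar P. J P y)"

subsection \<open>Master problems\<close>

definition S_cuts_ok :: "('nx::finite, 'ny::finite) state \<Rightarrow> real ^ 'ny \<Rightarrow> bool" where
  "S_cuts_ok s y \<longleftrightarrow> (\<forall>i\<in>S_set s. (ypt s i - ybar s i) \<bullet> (y - ybar s i) \<le> 0)"

definition J_cut ::
    "('nx::finite, 'ny::finite) minlp \<Rightarrow> ('nx, 'ny) state \<Rightarrow> nat \<Rightarrow> real ^ 'ny \<Rightarrow> ereal" where
  "J_cut P s i y = J P (ypt s i) + ereal (gJ s i \<bullet> (y - ypt s i))"

definition lin_constraints_ok ::
    "('nx::finite, 'ny::finite) minlp \<Rightarrow> (real ^ 'nx) \<times> (real ^ 'ny) \<Rightarrow>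
     (real ^ 'nx) \<times> (real ^ 'ny) \<Rightarrow> bool" where
  "lin_constraints_ok P zb z \<longleftrightarrow>
     (\<forall>i<n_g P. linz (con_g P i) zb z \<le> 0) \<and> (\<forall>j<n_h P. linz (con_h P j) zb z = 0)"

definition Jbar ::
    "('nx::finite, 'ny::finite) minlp \<Rightarrow> real \<Rightarrow> ('nx, 'ny) state \<Rightarrow> ereal" where
  "Jbar P \<alpha> s = ereal \<alpha> * J P (ypt s (best s)) + ereal (1 - \<alpha>) * LB s"

definition br_feas ::
    "('nx::finite, 'ny::finite) minlp \<Rightarrow> real \<Rightarrow> ('nx, 'ny) state \<Rightarrow>
     ((real ^ 'nx) \<times> (real ^ 'ny)) set" where
  "br_feas P \<alpha> s = {(x, y). x \<in> X_set P \<and> y \<in> Y_int P \<and>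
     lin_constraints_ok P (incumbent s) (x, y) \<and>
     (\<forall>i\<in>T_set s. J_cut P s i y \<le> Jbar P \<alpha> s) \<and> S_cuts_ok s y}"

definition br_opt ::
    "('nx::finite, 'ny::finite) minlp \<Rightarrow> real \<Rightarrow>
     ((real ^ 'nx) \<times> (real ^ 'ny) \<Rightarrow> (real ^ 'nx) \<times> (real ^ 'ny)) \<Rightarrow> ('nx, 'ny) state \<Rightarrow>
     (real ^ 'nx) \<times> (real ^ 'ny) \<Rightarrow> bool" where
  "br_opt P \<alpha> M s z \<longleftrightarrow>
     is_arg_min
       (\<lambda>z. linz (obj P) (incumbent s) z
            + 1 / 2 * ((z - incumbent s) \<bullet> M (z - incumbent s)))
       (\<lambda>z. z \<in> br_feas P \<alpha> s) z"

definition lb_feas ::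
    "('nx::finite, 'ny::finite) minlp \<Rightarrow> ('nx, 'ny) state \<Rightarrow>
     (real \<times> (real ^ 'nx) \<times> (real ^ 'ny)) set" where
  "lb_feas P s = {(\<eta>, x, y). x \<in> X_set P \<and> y \<in> Y_int P \<and>
     (best s \<in> T_set s \<longrightarrow>
        linz (obj P) (incumbent s) (x, y) \<le> \<eta> \<and> lin_constraints_ok P (incumbent s) (x, y)) \<and>
     (\<forall>i\<in>T_set s - {best s}. J_cut P s i y \<le> ereal \<eta>) \<and> S_cuts_ok s y}"

text \<open>As long as no feasible integer point is known, \<open>\<eta>\<close> does not occur in any constraint of
  LB-MILP. The problem is then a pure feasibility problem: every feasible point counts as a
  solution and the objective value is \<open>-\<infinity>\<close>, so that it does not affect the lower bound.\<close>

definition lb_opt ::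
    "('nx::finite, 'ny::finite) minlp \<Rightarrow> ('nx, 'ny) state \<Rightarrow> ereal \<Rightarrow>
     (real ^ 'nx) \<times> (real ^ 'ny) \<Rightarrow> bool" where
  "lb_opt P s V z \<longleftrightarrow>
     (if T_set s = {} then V = -\<infinity> \<and> (\<exists>\<eta>. (\<eta>, z) \<in> lb_feas P s)
      else (\<exists>\<eta>. V = ereal \<eta> \<and> is_arg_min fst (\<lambda>w. w \<in> lb_feas P s) (\<eta>, z)))"

subsection \<open>The algorithm as a transition relation\<close>

text \<open>Steps (i) and (ii) of an iteration.\<close>

inductive nlp_phase ::
    "('nx::finite, 'ny::finite) minlp \<Rightarrow> ('nx, 'ny) state \<Rightarrow> ('nx, 'ny) state \<Rightarrow> bool"
  for P :: "('nx::finite, 'ny::finite) minlp" where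
  feasible:
    "nlp_opt P (cur_y s) x \<Longrightarrow> is_gradJ P (cur_y s) x v \<Longrightarrow>
     nlp_phase P s (set_best P
       (s\<lparr>T_set := insert (iter s) (T_set s),
          xpt := (xpt s)(iter s := x),
          gJ := (gJ s)(iter s := v),
          UB := (if J P (cur_y s) < UB s then J P (cur_y s) else UB s)\<rparr>))"
| infeasible:
    "nlp_feas P (cur_y s) = {} \<Longrightarrow> fnlp_opt P (cur_y s) (feasible_best_y s) (x, yb) \<Longrightarrow>
     nlp_phase P s (set_best P
       (s\<lparr>S_set := insert (iter s) (S_set s),
          xpt := (xpt s)(iter s := x),
          ybar := (ybar s)(iter s := yb)\<rparr>))"

definition br_called :: "('nx::finite, 'ny::finite) state \<Rightarrow> bool" where
  "br_called s \<longleftrightarrow> int (iter s) - int (best s) \<le> 1"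

definition advance ::
    "real ^ 'ny \<Rightarrow> ('nx::finite, 'ny::finite) state \<Rightarrow> ('nx, 'ny) state" where
  "advance yt s = s\<lparr>ypt := (ypt s)(Suc (iter s) := yt), iter := Suc (iter s)\<rparr>"

text \<open>Steps (iii) to (v) of an iteration. If LB-MILP is infeasible, \<open>y\<close> keeps its value; it is
  not used any more, because the loop condition \<open>LB < UB\<close> then fails.\<close>

inductive master_phase ::
    "('nx::finite, 'ny::finite) minlp \<Rightarrow> real \<Rightarrow>
     ((real ^ 'nx) \<times> (real ^ 'ny) \<Rightarrow> (real ^ 'nx) \<times> (real ^ 'ny)) \<Rightarrow>
     ('nx, 'ny) state \<Rightarrow> ('nx, 'ny) state \<Rightarrow> bool"
  for P :: "('nx::finite, 'ny::finite) minlp" and \<alpha> M where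
  br:
    "br_called s \<Longrightarrow> br_opt P \<alpha> M s (x, yt) \<Longrightarrow> master_phase P \<alpha> M s (advance yt s)"
| lb_infeasible:
    "\<not> br_called s \<or> br_feas P \<alpha> s = {} \<Longrightarrow> lb_feas P s = {} \<Longrightarrow>
     master_phase P \<alpha> M s (advance (cur_y s) (s\<lparr>LB := \<infinity>\<rparr>))"
| lb:
    "\<not> br_called s \<or> br_feas P \<alpha> s = {} \<Longrightarrow> lb_opt P s V (x, yt) \<Longrightarrow>
     master_phase P \<alpha> M s (advance yt (s\<lparr>LB := (if V > LB s then V else LB s)\<rparr>))"

text \<open>The Hessian approximation may depend on the whole history, i.e. on the state in which
  BR-MIQP is set up.\<close>

definition sbmiqp_step ::
    "('nx::finite, 'ny::finite) minlp \<Rightarrow> real \<Rightarrow>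
     (('nx, 'ny) state \<Rightarrow> (real ^ 'nx) \<times> (real ^ 'ny) \<Rightarrow> (real ^ 'nx) \<times> (real ^ 'ny)) \<Rightarrow>
     ('nx, 'ny) state \<Rightarrow> ('nx, 'ny) state \<Rightarrow> bool" where
  "sbmiqp_step P \<alpha> B s s' \<longleftrightarrow>
     LB s < UB s \<and> (\<exists>s1. nlp_phase P s s1 \<and> master_phase P \<alpha> (B s1) s1 s')"

definition reachable ::
    "('nx::finite, 'ny::finite) minlp \<Rightarrow> real \<Rightarrow>
     (('nx, 'ny) state \<Rightarrow> (real ^ 'nx) \<times> (real ^ 'ny) \<Rightarrow> (real ^ 'nx) \<times> (real ^ 'ny)) \<Rightarrow>
     ('nx, 'ny) state \<Rightarrow> bool" where
  "reachable P \<alpha> B s \<longleftrightarrow> (\<exists>s0. initial_state P s0 \<and> (sbmiqp_step P \<alpha> B)\<^sup>*\<^sup>* s0 s)"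

definition returns_global_optimum ::
    "('nx::finite, 'ny::finite) minlp \<Rightarrow> ('nx, 'ny) state \<Rightarrow> bool" where
  "returns_global_optimum P s \<longleftrightarrow>
     minlp_opt P (incumbent s) \<and> UB s = ereal (obj P (incumbent s))"

text \<open>Termination with both bounds infinite; the second part says that the resulting
  classification of the MINLP is correct.\<close>

definition returns_infeasibility_certificate ::
    "('nx::finite, 'ny::finite) minlp \<Rightarrow> ('nx, 'ny) state \<Rightarrow> bool" where
  "returns_infeasibility_certificate P s \<longleftrightarrow>
     LB s = \<infinity> \<and> UB s = \<infinity> \<and> minlp_feas P = {}"

end

theory Submission
  imports Defs
begin

text \<open>
  Every cut is valid. The optimality cuts are: by convexity, and because the Mangasarian--Fromovitz
  condition yields multipliers at a solution \<open>x\<^sub>i\<close> of the NLP at \<open>y\<^sub>i\<close>, the function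
  \<open>J(y\<^sub>i) + \<nabla>J(y\<^sub>i) \<bullet> (y - y\<^sub>i)\<close> is a lower bound of the objective. A feasibility cut separates
  \<open>y\<^sub>i\<close> from the projection of the relaxed feasible set, since the trust region constraint is
  inactive at the projected point. Hence LB-MILP is a relaxation of the MINLP and \<open>LB\<close> is always a
  lower bound of its value; this gives correctness upon termination.

  A point from an infeasible NLP is cut off for good. If a master problem proposes again a point
  \<open>y\<^sub>i\<close> whose NLP was feasible, the cuts at \<open>y\<^sub>i\<close> read \<open>J(y\<^sub>i) \<le> \<alpha> J(y\<^sub>b) + (1 - \<alpha>) LB\<close> or
  \<open>J(y\<^sub>b) \<le> V\<close>, so the bounds have met. Thus a run visits pairwise distinct points of the
  finite set \<open>Y\<close>.

  For the run not to get stuck, the master problems must attain their minima. For fixed \<open>y\<close>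
  they are convex quadratic programs on polyhedra, bounded below because of the multipliers at the
  incumbent, and the Frank--Wolfe theorem applies.
\<close>

section \<open>Gradients and convexity\<close>

lemma GDERIV_unique:
  fixes \<phi> :: "'a::real_inner \<Rightarrow> real"
  assumes "GDERIV \<phi> z :> D" "GDERIV \<phi> z :> E"
  shows "D = E"
proof -
  have "(\<lambda>h. h \<bullet> D) = (\<lambda>h. h \<bullet> E)"
    using assms unfolding gderiv_def by (rule has_derivative_unique)
  then have "h \<bullet> D = h \<bullet> E" for h
    by metis
  then show ?thesis
    by (metis vector_eq_ldot)
qed

lemma grad_eqI: "GDERIV \<phi> z :> D \<Longrightarrow> grad \<phi> z = D"
  unfolding grad_def using GDERIV_unique by blast

text \<open>Riesz representation: a derivative is the inner product with the vector of its values on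
  \<open>Basis\<close>, and uniqueness lets \<open>grad\<close> pick that vector.\<close>

lemma has_derivative_imp_GDERIV:
  fixes \<phi> :: "'a::euclidean_space \<Rightarrow> real"
  assumes "(\<phi> has_derivative L) (at z)"
  shows "GDERIV \<phi> z :> grad \<phi> z"
proof -
  define D where "D = (\<Sum>b\<in>Basis. L b *\<^sub>R b)"
  have "linear L"
    using assms has_derivative_linear by blast
  have "L h = h \<bullet> D" for h
  proof -
    have "L h = L (\<Sum>b\<in>Basis. (h \<bullet> b) *\<^sub>R b)"
      by (simp add: euclidean_representation)
    also have "\<dots> = (\<Sum>b\<in>Basis. (h \<bullet> b) * L b)"
      by (simp add: linear_sum[OF \<open>linear L\<close>] linear_cmul[OF \<open>linear L\<close>])
    also have "\<dots> = h \<bullet> D"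
      by (simp add: D_def inner_sum_right mult.commute)
    finally show ?thesis .
  qed
  then have "L = (\<lambda>h. h \<bullet> D)"
    by blast
  then have "GDERIV \<phi> z :> D"
    using assms by (simp add: gderiv_def)
  then show ?thesis
    using grad_eqI by blast
qed

lemma twice_cont_differentiable_GDERIV:
  "twice_cont_differentiable \<phi> \<Longrightarrow> GDERIV \<phi> z :> grad \<phi> z"
  unfolding twice_cont_differentiable_def using has_derivative_imp_GDERIV by blast

lemma affine_fun_eq_linz:
  assumes "affine_fun \<phi>"
  shows "linz \<phi> zb z = \<phi> z"
proof -
  obtain a c where \<phi>: "\<And>z. \<phi> z = a \<bullet> z + c"
    using assms unfolding affine_fun_def by blast
  have "GDERIV \<phi> zb :> a"
    unfolding gderiv_def \<phi> by (auto intro!: derivative_eq_intros simp: inner_commute)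
  then show ?thesis
    by (simp add: linz_def grad_eqI \<phi> inner_diff_right)
qed

lemma GDERIV_along_line:
  fixes \<phi> :: "'a::real_inner \<Rightarrow> real"
  assumes "GDERIV \<phi> z :> D"
  shows "((\<lambda>t. \<phi> (z + t *\<^sub>R e)) has_real_derivative D \<bullet> e) (at 0)"
proof -
  have "((\<lambda>t. z + t *\<^sub>R e) has_derivative (\<lambda>t. t *\<^sub>R e)) (at 0)"
    by (auto intro!: derivative_eq_intros)
  moreover have "(\<phi> has_derivative (\<lambda>h. h \<bullet> D)) (at (z + 0 *\<^sub>R e))"
    using assms by (simp add: gderiv_def)
  ultimately have "((\<lambda>t. \<phi> (z + t *\<^sub>R e)) has_derivative (\<lambda>t. (t *\<^sub>R e) \<bullet> D)) (at 0)"
    by (rule has_derivative_compose)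
  then show ?thesis
    by (simp add: has_field_derivative_def inner_commute mult_commute_abs)
qed

text \<open>Convexity bounds the difference quotients towards \<open>z\<close> by the chord slope.
  It is available only on \<open>C\<close>, so the limit is taken from the right, along the segment
  from \<open>zb\<close> to \<open>z\<close>.\<close>

lemma convex_on_imp_linz_le:
  fixes \<phi> :: "'a::real_inner \<Rightarrow> real"
  assumes cvx: "convex_on C \<phi>" and der: "GDERIV \<phi> zb :> grad \<phi> zb"
    and "zb \<in> C" "z \<in> C"
  shows "linz \<phi> zb z \<le> \<phi> z"
proof -
  have "((\<lambda>t. \<phi> (zb + t *\<^sub>R (z - zb))) has_real_derivative grad \<phi> zb \<bullet> (z - zb)) (at_right 0)"
    using GDERIV_along_line[OF der] by (rule DERIV_subset) simp
  then have "((\<lambda>t. (\<phi> (zb + t *\<^sub>R (z - zb)) - \<phi> zb) / t) \<longlongrightarrow> grad \<phi> zb \<bullet> (z - zb)) (at_right 0)"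
    by (simp add: has_field_derivative_iff)
  moreover have "\<forall>\<^sub>F t in at_right (0::real). (\<phi> (zb + t *\<^sub>R (z - zb)) - \<phi> zb) / t \<le> \<phi> z - \<phi> zb"
    unfolding eventually_at_right_field
  proof (intro exI[of _ 1] conjI allI impI)
    fix t :: real
    assume t: "0 < t" "t < 1"
    have "zb + t *\<^sub>R (z - zb) = (1 - t) *\<^sub>R zb + t *\<^sub>R z"
      by (simp add: algebra_simps)
    then have "\<phi> (zb + t *\<^sub>R (z - zb)) \<le> (1 - t) * \<phi> zb + t * \<phi> z"
      using convex_onD[OF cvx, of t zb z] t assms by simp
    then show "(\<phi> (zb + t *\<^sub>R (z - zb)) - \<phi> zb) / t \<le> \<phi> z - \<phi> zb"
      using t by (simp add: field_simps)
  qed simp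
  ultimately have "grad \<phi> zb \<bullet> (z - zb) \<le> \<phi> z - \<phi> zb"
    by (rule tendsto_upperbound) simp
  then show ?thesis
    by (simp add: linz_def)
qed

section \<open>Polyhedra, Farkas' lemma and the Frank--Wolfe theorem\<close>

lemma polyhedron_halfspaces:
  fixes S :: "'a::euclidean_space set"
  assumes "polyhedron S"
  obtains K :: "'a set set" and a b where "finite K" "S = {x. \<forall>k\<in>K. a k \<bullet> x \<le> b k}"
proof -
  obtain F where F: "finite F" "S = \<Inter>F" "\<forall>h\<in>F. \<exists>a b. a \<noteq> 0 \<and> h = {x. a \<bullet> x \<le> b}"
    using assms unfolding polyhedron_def by blast
  obtain a b where "\<And>h. h \<in> F \<Longrightarrow> h = {x. a h \<bullet> x \<le> b h}"
    using F(3) by metis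
  then have "S = {x. \<forall>k\<in>F. a k \<bullet> x \<le> b k}"
    unfolding F(2) by blast
  then show ?thesis
    using that F(1) by blast
qed

text \<open>The nonnegative combinations form a convex cone containing the generators, hence contain
  the hull. Indexing by \<open>K\<close> rather than by its image keeps one multiplier per
  constraint even if gradients coincide.\<close>

lemma in_convex_cone_hull_imageE:
  assumes "finite K" "v \<in> convex_cone hull (a ` K)"
  obtains t where "\<And>k. k \<in> K \<Longrightarrow> 0 \<le> t k" "v = (\<Sum>k\<in>K. t k *\<^sub>R a k)"
proof -
  let ?C = "{\<Sum>k\<in>K. t k *\<^sub>R a k | t. \<forall>k\<in>K. 0 \<le> t k}"
  have "convex_cone hull (a ` K) \<subseteq> ?C"
  proof (rule hull_minimal)
    show "a ` K \<subseteq> ?C"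
    proof clarify
      fix k assume "k \<in> K"
      have "(\<Sum>j\<in>K. (if j = k then 1 else 0) *\<^sub>R a j) = (\<Sum>j\<in>K. if j = k then a j else 0)"
        by (rule sum.cong) auto
      also have "\<dots> = a k"
        using \<open>k \<in> K\<close> \<open>finite K\<close> by simp
      finally show "\<exists>t. a k = (\<Sum>k\<in>K. t k *\<^sub>R a k) \<and> (\<forall>k\<in>K. 0 \<le> t k)"
        by (intro exI[of _ "\<lambda>j. if j = k then 1 else 0"]) auto
    qed
    show "convex_cone ?C"
      unfolding convex_cone_iff
    proof (intro conjI ballI allI impI)
      show "0 \<in> ?C"
        by (auto intro!: exI[of _ "\<lambda>k. 0"])
    next
      fix u v assume "u \<in> ?C" "v \<in> ?C"
      then obtain s t where "u = (\<Sum>k\<in>K. s k *\<^sub>R a k)" "v = (\<Sum>k\<in>K. t k *\<^sub>R a k)"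
          "\<forall>k\<in>K. 0 \<le> s k" "\<forall>k\<in>K. 0 \<le> t k"
        by blast
      then show "u + v \<in> ?C"
        by (auto intro!: exI[of _ "\<lambda>k. s k + t k"] simp: scaleR_add_left sum.distrib)
    next
      fix u and c :: real assume "u \<in> ?C" "0 \<le> c"
      then obtain s where "u = (\<Sum>k\<in>K. s k *\<^sub>R a k)" "\<forall>k\<in>K. 0 \<le> s k"
        by blast
      then show "c *\<^sub>R u \<in> ?C"
        using \<open>0 \<le> c\<close> by (auto intro!: exI[of _ "\<lambda>k. c * s k"] simp: scaleR_sum_right)
    qed
  qed
  then show ?thesis
    using assms(2) that by blast
qed

text \<open>A finitely generated cone is closed, so a point outside it could be separated strictly.
  Scaling invariance makes the separating \<open>e\<close> nonnegative on the cone, and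
  \<open>- e\<close> then refutes the implication.\<close>

lemma farkas:
  fixes S :: "'a::euclidean_space set"
  assumes "finite S" and impl: "\<And>d. (\<forall>a\<in>S. a \<bullet> d \<le> 0) \<Longrightarrow> v \<bullet> d \<le> 0"
  shows "v \<in> convex_cone hull S"
proof (rule ccontr)
  let ?C = "convex_cone hull S"
  assume "v \<notin> ?C"
  then obtain e b where e: "e \<bullet> v < b" "\<And>x. x \<in> ?C \<Longrightarrow> b < e \<bullet> x"
    using separating_hyperplane_closed_point[of ?C v] convex_convex_cone_hull
      closed_convex_cone_hull[OF \<open>finite S\<close>] by blast
  have "b < 0"
    using e(2)[OF convex_cone_hull_contains_0] by simp
  have "0 \<le> e \<bullet> x" if "x \<in> ?C" for x
  proof (rule ccontr)
    assume neg: "\<not> 0 \<le> e \<bullet> x"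
    then have "(b / (e \<bullet> x)) *\<^sub>R x \<in> ?C"
      using that \<open>b < 0\<close> by (intro convex_cone_hull_mul) (auto simp: divide_nonpos_neg)
    from e(2)[OF this] neg show False
      by simp
  qed
  then have "\<forall>a\<in>S. a \<bullet> (- e) \<le> 0"
    by (simp add: hull_inc inner_commute)
  then have "v \<bullet> (- e) \<le> 0"
    by (rule impl)
  with e(1) \<open>b < 0\<close> show False
    by (simp add: inner_commute)
qed

text \<open>At \<open>d\<close> the form attains its minimum 0. Moving along \<open>- M d\<close>
  adds a linear term \<open>- 2 * t * (M d \<bullet> M d)\<close> and a quadratic one, so a small
  \<open>t > 0\<close> would give a negative value unless \<open>M d = 0\<close>.\<close>

lemma sym_psd_zero:
  assumes "sym_psd M" "d \<bullet> M d = 0"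
  shows "M d = 0"
proof -
  have lin: "linear M" and sym: "\<And>u v. M u \<bullet> v = u \<bullet> M v" and psd: "\<And>u. 0 \<le> u \<bullet> M u"
    using assms(1) unfolding sym_psd_def by auto
  let ?w = "M d"
  have le: "0 \<le> - 2 * t * (?w \<bullet> ?w) + t\<^sup>2 * (?w \<bullet> M ?w)" for t :: real
  proof -
    have "0 \<le> (d - t *\<^sub>R ?w) \<bullet> M (d - t *\<^sub>R ?w)"
      by (rule psd)
    also have "\<dots> = - 2 * t * (?w \<bullet> ?w) + t\<^sup>2 * (?w \<bullet> M ?w)"
      using assms(2) sym[of d "M d"]
      by (simp add: linear_diff[OF lin] linear_cmul[OF lin] inner_diff_left inner_diff_right
          power2_eq_square inner_commute algebra_simps)
    finally show ?thesis .
  qed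
  define p where "p = ?w \<bullet> ?w"
  define q where "q = ?w \<bullet> M ?w"
  have "0 \<le> p" "0 \<le> q"
    using psd by (auto simp: p_def q_def)
  \<comment> \<open>The step length \<open>p / (q + 1)\<close> is short enough for the linear term
    to win; adding 1 covers \<open>q = 0\<close>.\<close>
  have "0 \<le> - 2 * (p / (q + 1)) * p + (p / (q + 1))\<^sup>2 * q"
    using le[of "p / (q + 1)"] by (simp add: p_def q_def)
  also have "\<dots> = - (p\<^sup>2 / (q + 1)) * (2 - q / (q + 1))"
    by (simp add: power2_eq_square divide_inverse algebra_simps)
  finally have *: "p\<^sup>2 / (q + 1) * (2 - q / (q + 1)) \<le> 0"
    by simp
  have "q / (q + 1) < 2"
    using \<open>0 \<le> q\<close> by (simp add: field_simps)
  then have "p\<^sup>2 / (q + 1) \<le> 0"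
    using * unfolding mult_le_0_iff by linarith
  then have "p = 0"
    using \<open>0 \<le> q\<close> by (simp add: divide_le_0_iff)
  then show ?thesis
    by (simp add: p_def)
qed

lemma sym_psd_zero_map: "sym_psd (\<lambda>_ :: 'a::real_inner. 0 :: 'a)"
  by (simp add: sym_psd_def linear_iff)

text \<open>The Frank--Wolfe theorem for convex quadratics. Take minimizers of the norm in sublevel
  sets shrinking to the infimum. If they were unbounded, their directions would accumulate at a
  direction of recession \<open>d\<close> along which the objective is constant, and subtracting \<open>d\<close> from
  a late iterate would shorten it.\<close>

lemma convex_quadratic_attains_min:
  fixes S :: "'a::euclidean_space set" and c :: 'a and M :: "'a \<Rightarrow> 'a"
  defines "q \<equiv> \<lambda>x. c \<bullet> x + 1 / 2 * (x \<bullet> M x)"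
  assumes "polyhedron S" "S \<noteq> {}" and M: "sym_psd M" and bd: "\<And>x. x \<in> S \<Longrightarrow> m \<le> q x"
  shows "\<exists>x\<in>S. \<forall>y\<in>S. q x \<le> q y"
proof -
  have lin: "linear M" and sym: "\<And>u v. M u \<bullet> v = u \<bullet> M v" and psd: "\<And>u. 0 \<le> u \<bullet> M u"
    using M unfolding sym_psd_def by auto
  have contM: "continuous_on UNIV M"
    using lin by (simp add: linear_continuous_on linear_conv_bounded_linear)
  have contq: "continuous_on UNIV q"
    unfolding q_def by (intro continuous_intros contM)
  obtain K :: "'a set set" and a b where K: "finite K" and S: "S = {x. \<forall>k\<in>K. a k \<bullet> x \<le> b k}"
    by (rule polyhedron_halfspaces[OF \<open>polyhedron S\<close>])
  define I where "I = (INF x\<in>S. q x)"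
  have bdd: "bdd_below (q ` S)"
    using bd by (auto simp: bdd_below_def)
  have I_le: "I \<le> q x" if "x \<in> S" for x
    unfolding I_def using bdd that by (simp add: cINF_lower)
  define L where "L n = {x \<in> S. q x \<le> I + 1 / real (Suc n)}" for n
  have L_ne: "L n \<noteq> {}" for n
  proof -
    have "\<exists>x\<in>S. q x < I + 1 / real (Suc n)"
      using cINF_less_iff[of S q "I + 1 / real (Suc n)"] bdd \<open>S \<noteq> {}\<close> by (simp add: I_def)
    then show ?thesis
      by (auto simp: L_def intro: less_imp_le)
  qed
  have L_closed: "closed (L n)" for n
  proof -
    have "L n = S \<inter> {x. q x \<le> I + 1 / real (Suc n)}"
      by (auto simp: L_def)
    moreover have "closed {x. q x \<le> I + 1 / real (Suc n)}"
      by (intro closed_Collect_le contq continuous_on_const)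
    ultimately show ?thesis
      using \<open>polyhedron S\<close> polyhedron_imp_closed by auto
  qed
  have "\<exists>x\<in>L n. \<forall>y\<in>L n. norm x \<le> norm y" for n
    using distance_attains_inf[OF L_closed[of n] L_ne[of n], of 0] by (metis dist_0_norm)
  then obtain u where u: "\<And>n. u n \<in> L n" "\<And>n y. y \<in> L n \<Longrightarrow> norm (u n) \<le> norm y"
    by metis
  have uS: "u n \<in> S" and uq: "q (u n) \<le> I + 1 / real (Suc n)" for n
    using u(1)[of n] by (auto simp: L_def)
  have inv0: "(\<lambda>n. 1 / real (Suc n)) \<longlonglongrightarrow> 0"
    using LIMSEQ_inverse_real_of_nat by (simp add: inverse_eq_divide)
  show ?thesis
  proof (cases "bounded (range u)")
    case True
    then obtain l r where r: "strict_mono r" "(u \<circ> r) \<longlonglongrightarrow> l"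
      using bounded_imp_convergent_subsequence by blast
    have "l \<in> S"
      using polyhedron_imp_closed[OF \<open>polyhedron S\<close>] r(2) uS
      by (metis closed_sequential_limits comp_apply)
    have "(\<lambda>n. q ((u \<circ> r) n)) \<longlonglongrightarrow> q l"
      using contq r(2) by (rule continuous_on_tendsto_compose) auto
    moreover have "(\<lambda>n. I + 1 / real (Suc (r n))) \<longlonglongrightarrow> I + 0"
      using LIMSEQ_subseq_LIMSEQ[OF inv0 r(1)] by (intro tendsto_intros) (simp add: o_def)
    ultimately have "q l \<le> I + 0"
      using uq by (intro LIMSEQ_le) auto
    then show ?thesis
      using \<open>l \<in> S\<close> I_le by force
  next
    case False
    have "\<exists>k\<ge>n. real n < norm (u k)" for n
    proof (rule ccontr)
      assume "\<not> (\<exists>k\<ge>n. real n < norm (u k))"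
      then have le: "norm (u k) \<le> real n" if "k \<ge> n" for k
        using that by (meson not_le)
      have "range u = u ` {..<n} \<union> u ` {n..}"
        using ivl_disj_un_one(8)[of 0 n] by (simp add: lessThan_atLeast0 atLeast_0 flip: image_Un)
      moreover have "bounded (u ` {..<n})"
        by (simp add: finite_imp_bounded)
      moreover have "bounded (u ` {n..})"
        using le by (auto simp: bounded_iff)
      ultimately show False
        using False by simp
    qed
    then obtain s where s: "\<And>n. n \<le> s n" "\<And>n. real n < norm (u (s n))"
      by metis
    define w where "w n = u (s n)" for n
    define d where "d n = w n /\<^sub>R norm (w n)" for n
    have wpos: "norm (w n) > 0" for n
      using s(2)[of n] by (simp add: w_def) (metis norm_le_zero_iff not_le of_nat_0_le_iff order_le_less_trans norm_zero)
    have "norm (d n) = 1" for n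
      using wpos[of n] by (simp add: d_def)
    then have "bounded (range d)"
      by (auto simp: bounded_iff intro!: exI[of _ 1])
    then obtain e r where r: "strict_mono r" "(d \<circ> r) \<longlonglongrightarrow> e"
      using bounded_imp_convergent_subsequence by blast
    define v where "v n = w (r n)" for n
    define N where "N n = norm (v n)" for n
    have Npos: "N n > 0" for n
      using wpos by (simp add: N_def v_def)
    have "filterlim (\<lambda>n. real (r n)) at_top sequentially"
      using filterlim_compose[OF filterlim_real_sequentially filterlim_subseq[OF r(1)]] .
    moreover have "real (r n) \<le> N n" for n
      using s(2)[of "r n"] by (simp add: N_def v_def w_def)
    ultimately have Ntop: "filterlim N at_top sequentially"
      by (rule filterlim_at_top_mono[OF _ always_eventually[OF allI]])
    have Ninv: "(\<lambda>n. inverse (N n)) \<longlonglongrightarrow> 0"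
      using Ntop tendsto_inverse_0_at_top by blast
    have vlim: "(\<lambda>n. v n /\<^sub>R N n) \<longlonglongrightarrow> e"
      using r(2) by (simp add: o_def d_def v_def N_def)
    have lim: "(\<lambda>n. (p \<bullet> v n) / N n) \<longlonglongrightarrow> p \<bullet> e" for p
      using tendsto_inner[OF tendsto_const vlim, of p] by (simp add: divide_inverse_commute)
    have vS: "v n \<in> S" for n
      using uS by (simp add: v_def w_def)
    have vq: "q (v n) \<le> I + 1" for n
    proof -
      have "1 / real (Suc (s (r n))) \<le> 1"
        by simp
      then show ?thesis
        using uq[of "s (r n)"] unfolding v_def w_def by linarith
    qed
    have "norm e = 1"
    proof -
      have "(\<lambda>n. norm (v n /\<^sub>R N n)) \<longlonglongrightarrow> norm e"
        by (intro tendsto_norm vlim)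
      moreover have "norm (v n /\<^sub>R N n) = 1" for n
        using Npos[of n] by (simp add: N_def)
      ultimately show ?thesis
        by (simp add: LIMSEQ_const_iff)
    qed
    \<comment> \<open>Dividing the constraints by \<open>N n\<close>, which tends to infinity,
      removes their right-hand sides: \<open>e\<close> is a direction of recession of
      \<open>S\<close>.\<close>
    have ae: "a k \<bullet> e \<le> 0" if "k \<in> K" for k
    proof -
      have "(a k \<bullet> v n) / N n \<le> b k * inverse (N n)" for n
        using vS[of n] that Npos[of n] S by (simp add: field_simps)
      moreover have "(\<lambda>n. b k * inverse (N n)) \<longlonglongrightarrow> b k * 0"
        by (intro tendsto_mult tendsto_const Ninv)
      ultimately show ?thesis
        using LIMSEQ_le[OF lim, of "\<lambda>n. b k * inverse (N n)" "b k * 0"] by auto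
    qed
    have Mlim: "(\<lambda>n. M (v n /\<^sub>R N n)) \<longlonglongrightarrow> M e"
      by (rule continuous_on_tendsto_compose[OF contM vlim]) auto
    \<comment> \<open>Dividing by the square of \<open>N n\<close> leaves only the quadratic part in
      the limit, so the upper bound on \<open>q (v n)\<close> forces
      \<open>e \<bullet> M e \<le> 0\<close>.\<close>
    have quad: "(1 / 2) * (e \<bullet> M e) \<le> 0"
    proof -
      have "(\<lambda>n. (c \<bullet> v n) / N n * inverse (N n) + 1 / 2 * ((v n /\<^sub>R N n) \<bullet> M (v n /\<^sub>R N n)))
          \<longlonglongrightarrow> (c \<bullet> e) * 0 + 1 / 2 * (e \<bullet> M e)"
        by (intro tendsto_add tendsto_mult tendsto_inner tendsto_const lim Ninv vlim Mlim)
      moreover have "(\<lambda>n. (I + 1) * (inverse (N n) * inverse (N n))) \<longlonglongrightarrow> (I + 1) * (0 * 0)"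
        by (intro tendsto_mult tendsto_const Ninv)
      moreover have "(c \<bullet> v n) / N n * inverse (N n) + 1 / 2 * ((v n /\<^sub>R N n) \<bullet> M (v n /\<^sub>R N n))
          \<le> (I + 1) * (inverse (N n) * inverse (N n))" for n
      proof -
        have "(c \<bullet> v n) / N n * inverse (N n) + 1 / 2 * ((v n /\<^sub>R N n) \<bullet> M (v n /\<^sub>R N n))
            = q (v n) * (inverse (N n) * inverse (N n))"
          by (simp add: q_def linear_cmul[OF lin] divide_inverse_commute[of _ "N n"] distrib_right)
        also have "\<dots> \<le> (I + 1) * (inverse (N n) * inverse (N n))"
          using vq[of n] by (intro mult_right_mono) auto
        finally show ?thesis .
      qed
      ultimately have "(c \<bullet> e) * 0 + 1 / 2 * (e \<bullet> M e) \<le> (I + 1) * (0 * 0)"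
        by (intro LIMSEQ_le[of _ _ _ "(I + 1) * (0 * 0)"]) blast+
      then show ?thesis
        by simp
    qed
    then have Me: "M e = 0"
      using sym_psd_zero[OF M] psd[of e] by simp
    have "c \<bullet> e \<le> 0"
    proof -
      have "(c \<bullet> v n) / N n \<le> (I + 1) * inverse (N n)" for n
        using vq[of n] psd[of "v n"] Npos[of n] by (simp add: q_def field_simps)
      moreover have "(\<lambda>n. (I + 1) * inverse (N n)) \<longlonglongrightarrow> (I + 1) * 0"
        by (intro tendsto_mult tendsto_const Ninv)
      ultimately show ?thesis
        using LIMSEQ_le[OF lim, of "\<lambda>n. (I + 1) * inverse (N n)" "(I + 1) * 0"] by auto
    qed
    have q_shift: "q (x + t *\<^sub>R e) = q x + t * (c \<bullet> e)" for x t
      using sym[of e x] by (simp add: q_def linear_add[OF lin] linear_cmul[OF lin] Me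
          inner_add_left inner_add_right)
    have "0 \<le> c \<bullet> e"
    proof (rule ccontr)
      assume neg: "\<not> 0 \<le> c \<bullet> e"
      \<comment> \<open>The step at which the objective, linear along \<open>e\<close>, would drop
        to \<open>m - 1\<close>.\<close>
      define t where "t = (m - 1 - q (v 0)) / (c \<bullet> e)"
      have "m \<le> q (v 0)"
        using bd vS by blast
      then have "0 \<le> t"
        using neg by (simp add: t_def divide_nonpos_neg)
      have "a k \<bullet> (v 0 + t *\<^sub>R e) \<le> b k" if "k \<in> K" for k
        using vS[of 0] S that mult_nonneg_nonpos[OF \<open>0 \<le> t\<close> ae[OF that]]
        by (simp add: inner_add_right add_decreasing2)
      then have "v 0 + t *\<^sub>R e \<in> S"
        using S by blast
      then have "m \<le> q (v 0 + t *\<^sub>R e)"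
        by (rule bd)
      then show False
        using neg by (simp add: q_shift t_def)
    qed
    with \<open>c \<bullet> e \<le> 0\<close> have "c \<bullet> e = 0"
      by simp
    have "\<forall>\<^sub>F n in sequentially. a k \<bullet> (v n - e) \<le> b k" if "k \<in> K" for k
    \<comment> \<open>Constraints constant along \<open>e\<close> are unaffected by subtracting
      \<open>e\<close>; for the others the slack at \<open>v n\<close> tends to infinity.\<close>
    proof (cases "a k \<bullet> e = 0")
      case True
      then show ?thesis
        using vS that S by (auto simp: inner_diff_right)
    next
      case False
      then have neg: "a k \<bullet> e < 0"
        using ae that by force
      have "filterlim (\<lambda>n. (a k \<bullet> v n) / N n * N n) at_bot sequentially"
        using filterlim_tendsto_neg_mult_at_bot[OF lim neg Ntop] .
      then have "filterlim (\<lambda>n. a k \<bullet> v n) at_bot sequentially"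
        using Npos by (simp add: less_imp_neq[symmetric])
      then have "\<forall>\<^sub>F n in sequentially. a k \<bullet> v n \<le> b k + a k \<bullet> e"
        by (simp add: filterlim_at_bot)
      then show ?thesis
        by (rule eventually_mono) (simp add: inner_diff_right)
    qed
    then have "\<forall>\<^sub>F n in sequentially. \<forall>k\<in>K. a k \<bullet> (v n - e) \<le> b k"
      using K by (simp add: eventually_ball_finite)
    moreover have "\<forall>\<^sub>F n in sequentially. 1 / 2 < (e \<bullet> v n) / N n"
      using order_tendstoD(1)[OF lim[of e], of "1/2"] \<open>norm e = 1\<close>
      by (simp add: norm_eq_1)
    moreover have "\<forall>\<^sub>F n in sequentially. 1 \<le> N n"
      using Ntop by (simp add: filterlim_at_top)
    ultimately have "\<forall>\<^sub>F n in sequentially.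
        (\<forall>k\<in>K. a k \<bullet> (v n - e) \<le> b k) \<and> 1 / 2 < (e \<bullet> v n) / N n \<and> 1 \<le> N n"
      by (intro eventually_conj)
    then obtain n where n: "\<forall>k\<in>K. a k \<bullet> (v n - e) \<le> b k" "1 / 2 < (e \<bullet> v n) / N n" "1 \<le> N n"
      using eventually_happens'[OF sequentially_bot] by blast
    have "v n - e \<in> S"
      using n(1) S by simp
    moreover have "q (v n - e) = q (v n)"
      using q_shift[of "v n" "-1"] \<open>c \<bullet> e = 0\<close> by simp
    \<comment> \<open>Equal objective values keep the shifted point in the sublevel set where
      \<open>v n\<close> has least norm. Expanding the square then contradicts
      \<open>1 / 2 < (e \<bullet> v n) / N n\<close> and \<open>1 \<le> N n\<close>.\<close>
    ultimately have "v n - e \<in> L (s (r n))"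
      using u(1)[of "s (r n)"] by (simp add: L_def v_def w_def)
    then have "norm (v n) \<le> norm (v n - e)"
      using u(2) by (simp add: v_def w_def)
    then have "(norm (v n))\<^sup>2 \<le> (norm (v n - e))\<^sup>2"
      by (simp add: power_mono)
    also have "\<dots> = (norm (v n))\<^sup>2 - 2 * (e \<bullet> v n) + 1"
      using \<open>norm e = 1\<close>
      by (simp add: power2_norm_eq_inner inner_diff_left inner_diff_right inner_commute norm_eq_1)
    finally have "e \<bullet> v n \<le> 1 / 2"
      by simp
    moreover have "1 / 2 * N n < e \<bullet> v n"
      using n(2) Npos[of n] by (simp add: field_simps)
    ultimately show ?thesis
      using n(3) by simp
  qed
qed

section \<open>Multipliers under the Mangasarian--Fromovitz condition\<close>

lemma GDERIV_neg_decreases: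
  fixes \<phi> :: "'a::real_inner \<Rightarrow> real"
  assumes "GDERIV \<phi> x :> D" "D \<bullet> e < 0"
  shows "\<forall>\<^sub>F t in at_right 0. \<phi> (x + t *\<^sub>R e) < \<phi> x"
proof -
  obtain \<delta> where "\<delta> > 0" "\<And>h. 0 < h \<Longrightarrow> h < \<delta> \<Longrightarrow> \<phi> (x + (0 + h) *\<^sub>R e) < \<phi> (x + 0 *\<^sub>R e)"
    using DERIV_neg_dec_right[OF GDERIV_along_line[OF assms(1)] assms(2)] by blast
  then show ?thesis
    unfolding eventually_at_right_field by (intro exI[of _ \<delta>]) auto
qed

lemma GDERIV_less_stays_less:
  fixes \<phi> :: "'a::real_inner \<Rightarrow> real"
  assumes "GDERIV \<phi> x :> D" "\<phi> x < r"
  shows "\<forall>\<^sub>F t in at_right 0. \<phi> (x + t *\<^sub>R e) < r"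
proof -
  have "isCont (\<lambda>t. \<phi> (x + t *\<^sub>R e)) 0"
    using GDERIV_along_line[OF assms(1)] DERIV_isCont by blast
  then have "((\<lambda>t. \<phi> (x + t *\<^sub>R e)) \<longlongrightarrow> \<phi> x) (at_right 0)"
    by (simp add: isCont_def filterlim_at_split)
  then show ?thesis
    using assms(2) order_tendstoD(2) by blast
qed

text \<open>Representing \<open>X\<close> by halfspaces makes all constraints of the linearized system explicit, so
  that Farkas' lemma applies; the multipliers of the halfspaces are then eliminated again,
  leaving stationarity along the directions pointing into \<open>X\<close>.\<close>

lemma kkt_multipliers_exist:
  fixes \<phi> :: "'a::euclidean_space \<Rightarrow> real" and G H :: "nat \<Rightarrow> 'a \<Rightarrow> real"
  assumes "polyhedron X" "x \<in> X"
    and G0: "\<And>i. i < p \<Longrightarrow> G i x \<le> 0" and H0: "\<And>j. j < q \<Longrightarrow> H j x = 0"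
    and min: "\<And>z. z \<in> X \<Longrightarrow> (\<forall>i<p. G i z \<le> 0) \<Longrightarrow> (\<forall>j<q. H j z = 0) \<Longrightarrow> \<phi> x \<le> \<phi> z"
    and d\<phi>: "GDERIV \<phi> x :> v" and dG: "\<And>i. i < p \<Longrightarrow> GDERIV (G i) x :> g i"
    and H: "\<And>j z. j < q \<Longrightarrow> H j z = H j x + h j \<bullet> (z - x)"
    and "x0 \<in> X" and x0_eq: "\<And>j. j < q \<Longrightarrow> h j \<bullet> (x0 - x) = 0"
    and x0_less: "\<And>i. i < p \<Longrightarrow> G i x = 0 \<Longrightarrow> g i \<bullet> (x0 - x) < 0"
  shows "\<exists>lam mu. (\<forall>i<p. 0 \<le> lam i \<and> lam i * G i x = 0) \<and>
    (\<forall>z\<in>X. 0 \<le> (v + (\<Sum>i<p. lam i *\<^sub>R g i) + (\<Sum>j<q. mu j *\<^sub>R h j)) \<bullet> (z - x))"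
proof -
  obtain K :: "'a set set" and a b where K: "finite K" and X: "X = {x. \<forall>k\<in>K. a k \<bullet> x \<le> b k}"
    by (rule polyhedron_halfspaces[OF \<open>polyhedron X\<close>])
  define A where "A = {k \<in> K. a k \<bullet> x = b k}"
  define I where "I = {i. i < p \<and> G i x = 0}"
  \<comment> \<open>Equality gradients enter with both signs, which yields multipliers of arbitrary
    sign; of the inequalities and halfspaces only the active ones enter.\<close>
  let ?S = "g ` I \<union> (h ` {..<q} \<union> (\<lambda>j. - h j) ` {..<q}) \<union> a ` A"
  have fin: "finite A" "finite I"
    using K by (auto simp: A_def I_def)
  have key: "0 \<le> v \<bullet> d"
    if dg: "\<forall>i\<in>I. g i \<bullet> d \<le> 0" and dh: "\<forall>j<q. h j \<bullet> d = 0" and da: "\<forall>k\<in>A. a k \<bullet> d \<le> 0" for d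
  proof (rule ccontr)
    assume neg: "\<not> 0 \<le> v \<bullet> d"
    \<comment> \<open>Tilting \<open>d\<close> by this multiple of \<open>x0 - x\<close> makes
      active inequalities strictly decreasing but uses up at most half of the descent
      \<open>v \<bullet> d\<close>; adding 1 avoids a zero denominator.\<close>
    define \<epsilon> where "\<epsilon> = - (v \<bullet> d) / 2 / (\<bar>v \<bullet> (x0 - x)\<bar> + 1)"
    have "0 < \<epsilon>"
      using neg by (simp add: \<epsilon>_def divide_neg_pos)
    define e where "e = d + \<epsilon> *\<^sub>R (x0 - x)"
    have "\<epsilon> * (v \<bullet> (x0 - x)) \<le> \<epsilon> * (\<bar>v \<bullet> (x0 - x)\<bar> + 1)"
      using \<open>0 < \<epsilon>\<close> by (intro mult_left_mono) auto
    also have "\<dots> = - (v \<bullet> d) / 2"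
    proof -
      have "\<bar>v \<bullet> (x0 - x)\<bar> + 1 \<noteq> 0"
        by linarith
      then show ?thesis
        unfolding \<epsilon>_def by (metis nonzero_divide_eq_eq)
    qed
    finally have ve: "v \<bullet> e < 0"
      using neg by (simp add: e_def inner_add_right)
    have ge: "g i \<bullet> e < 0" if "i \<in> I" for i
      using dg that x0_less[of i] \<open>0 < \<epsilon>\<close>
      by (auto simp: e_def inner_add_right I_def intro!: add_nonpos_neg mult_pos_neg)
    have he: "h j \<bullet> e = 0" if "j < q" for j
      using dh x0_eq that by (simp add: e_def inner_add_right)
    have ae: "a k \<bullet> e \<le> 0" if "k \<in> A" for k
    proof -
      have "a k \<bullet> (x0 - x) \<le> 0"
        using \<open>x0 \<in> X\<close> that X by (auto simp: A_def inner_diff_right)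
      then show ?thesis
        using da that \<open>0 < \<epsilon>\<close>
        by (auto simp: e_def inner_add_right intro!: add_nonpos_nonpos mult_nonneg_nonpos)
    qed
    have "\<forall>\<^sub>F t in at_right 0. a k \<bullet> (x + t *\<^sub>R e) \<le> b k" if "k \<in> K" for k
    proof (cases "k \<in> A")
      case True
      have "\<forall>\<^sub>F t in at_right (0::real). 0 < t"
        by (rule eventually_at_right_less)
      then show ?thesis
      proof (rule eventually_mono)
        fix t :: real assume "0 < t"
        then have "t * (a k \<bullet> e) \<le> 0"
          using ae[OF True] by (simp add: mult_nonneg_nonpos)
        then show "a k \<bullet> (x + t *\<^sub>R e) \<le> b k"
          using True by (simp add: A_def inner_add_right)
      qed
    next
      case False
      then have "a k \<bullet> x < b k"
        using \<open>x \<in> X\<close> X that by (force simp: A_def)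
      moreover have "GDERIV (\<lambda>z. a k \<bullet> z) x :> a k"
        unfolding gderiv_def by (auto intro!: derivative_eq_intros simp: inner_commute)
      ultimately have "\<forall>\<^sub>F t in at_right 0. a k \<bullet> (x + t *\<^sub>R e) < b k"
        using GDERIV_less_stays_less by blast
      then show ?thesis
        by (rule eventually_mono) simp
    qed
    then have evX: "\<forall>\<^sub>F t in at_right 0. x + t *\<^sub>R e \<in> X"
      unfolding X using K by (simp add: eventually_ball_finite)
    have "\<forall>\<^sub>F t in at_right 0. G i (x + t *\<^sub>R e) < 0" if "i < p" for i
    proof (cases "i \<in> I")
      case True
      then show ?thesis
        using GDERIV_neg_decreases[OF dG ge, of i] that by (auto simp: I_def)
    next
      case False
      then have "G i x < 0"
        using G0[OF that] that by (auto simp: I_def less_le)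
      then show ?thesis
        using GDERIV_less_stays_less[OF dG] that by blast
    qed
    then have evG: "\<forall>\<^sub>F t in at_right 0. \<forall>i\<in>{..<p}. G i (x + t *\<^sub>R e) < 0"
      by (intro eventually_ball_finite) auto
    have "\<forall>\<^sub>F t in at_right 0. x + t *\<^sub>R e \<in> X \<and> (\<forall>i\<in>{..<p}. G i (x + t *\<^sub>R e) < 0) \<and>
        \<phi> (x + t *\<^sub>R e) < \<phi> x"
      by (intro eventually_conj evX evG GDERIV_neg_decreases[OF d\<phi> ve])
    \<comment> \<open>Short steps along \<open>e\<close> stay feasible, the equalities exactly
      because they are affine, and decrease \<open>\<phi>\<close>, against minimality.\<close>
    then obtain t where t: "x + t *\<^sub>R e \<in> X" "\<forall>i\<in>{..<p}. G i (x + t *\<^sub>R e) < 0"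
        "\<phi> (x + t *\<^sub>R e) < \<phi> x"
      using eventually_happens'[OF trivial_limit_at_right_real] by blast
    moreover have "H j (x + t *\<^sub>R e) = 0" if "j < q" for j
      using H[OF that, of "x + t *\<^sub>R e"] H0[OF that] he[OF that] by simp
    ultimately show False
      using min[of "x + t *\<^sub>R e"] by force
  qed
  have "- v \<in> convex_cone hull ?S"
  proof (rule farkas)
    show "finite ?S"
      using fin by simp
  next
    fix d assume d: "\<forall>s\<in>?S. s \<bullet> d \<le> 0"
    have "0 \<le> v \<bullet> d"
    proof (rule key)
      show "\<forall>j<q. h j \<bullet> d = 0"
        using d by (force simp: ball_Un intro: antisym)
    qed (use d in auto)
    then show "- v \<bullet> d \<le> 0"
      by simp
  qed
  then obtain s1 s2 s3 s4 where s: "s1 \<in> convex_cone hull (g ` I)" "s2 \<in> convex_cone hull (h ` {..<q})"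
      "s3 \<in> convex_cone hull ((\<lambda>j. - h j) ` {..<q})" "s4 \<in> convex_cone hull (a ` A)"
      "- v = s1 + (s2 + s3) + s4"
    unfolding convex_cone_hull_Un by blast
  obtain l where l: "\<And>i. i \<in> I \<Longrightarrow> 0 \<le> l i" "s1 = (\<Sum>i\<in>I. l i *\<^sub>R g i)"
    using in_convex_cone_hull_imageE[OF fin(2) s(1)] by blast
  obtain m1 where m1: "s2 = (\<Sum>j<q. m1 j *\<^sub>R h j)"
    using in_convex_cone_hull_imageE[OF _ s(2)] by blast
  obtain m2 where m2: "s3 = (\<Sum>j<q. m2 j *\<^sub>R - h j)"
    using in_convex_cone_hull_imageE[OF _ s(3)] by blast
  obtain n where n: "\<And>k. k \<in> A \<Longrightarrow> 0 \<le> n k" "s4 = (\<Sum>k\<in>A. n k *\<^sub>R a k)"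
    using in_convex_cone_hull_imageE[OF fin(1) s(4)] by blast
  define lam where "lam i = (if i \<in> I then l i else 0)" for i
  define mu where "mu j = m1 j - m2 j" for j
  have "(\<Sum>i<p. lam i *\<^sub>R g i) = s1"
    unfolding l(2) by (rule sum.mono_neutral_cong_right) (auto simp: lam_def I_def)
  moreover have "(\<Sum>j<q. mu j *\<^sub>R h j) = s2 + s3"
    by (simp add: m1 m2 mu_def scaleR_diff_left sum_subtractf sum_negf)
  moreover have "v = - (s1 + (s2 + s3) + s4)"
    using s(5) by (metis minus_minus)
  \<comment> \<open>What remains of stationarity is \<open>- s4\<close>, with \<open>s4\<close> in
    the normal cone of \<open>X\<close> at \<open>x\<close>.\<close>
  ultimately have eq: "v + (\<Sum>i<p. lam i *\<^sub>R g i) + (\<Sum>j<q. mu j *\<^sub>R h j) = - s4"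
    by simp
  have "0 \<le> (v + (\<Sum>i<p. lam i *\<^sub>R g i) + (\<Sum>j<q. mu j *\<^sub>R h j)) \<bullet> (z - x)" if "z \<in> X" for z
  proof -
    have "s4 \<bullet> (z - x) = (\<Sum>k\<in>A. n k * (a k \<bullet> (z - x)))"
      by (simp add: n(2) inner_sum_left)
    also have "\<dots> \<le> 0"
      using that n(1) X
      by (intro sum_nonpos mult_nonneg_nonpos) (auto simp: A_def inner_diff_right)
    finally show ?thesis
      unfolding eq by simp
  qed
  moreover have "0 \<le> lam i" "lam i * G i x = 0" for i
    using l(1) by (auto simp: lam_def I_def)
  ultimately show ?thesis
    by blast
qed

section \<open>Validity of the cuts\<close>

text \<open>Splits mixed-integer minimization: \<open>k\<close> extracts the integer part, the
  problem on each fibre is solved separately, and the best of finitely many fibre minimizers is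
  taken.\<close>

lemma finite_fibres_attain_min:
  fixes F :: "'a \<Rightarrow> real"
  assumes "finite Q" "D \<noteq> {}" "k ` D \<subseteq> Q"
    and fibre: "\<And>w. w \<in> D \<Longrightarrow> \<exists>z\<in>D. \<forall>z'\<in>D. k z' = k w \<longrightarrow> F z \<le> F z'"
  shows "\<exists>z\<in>D. \<forall>z'\<in>D. F z \<le> F z'"
proof -
  obtain m where m: "\<And>w. w \<in> D \<Longrightarrow> m w \<in> D" "\<And>w z'. w \<in> D \<Longrightarrow> z' \<in> D \<Longrightarrow> k z' = k w \<Longrightarrow> F (m w) \<le> F z'"
    using fibre by metis
  define r where "r = inv_into D k"
  have r: "r y \<in> D \<and> k (r y) = y" if "y \<in> k ` D" for y
    using that unfolding r_def by (simp add: inv_into_into f_inv_into_f)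
  have fin: "finite (k ` D)"
    using assms finite_subset by blast
  then obtain y where y: "is_arg_min (\<lambda>y. F (m (r y))) (\<lambda>y. y \<in> k ` D) y"
    using ex_is_arg_min_if_finite[OF fin, of "\<lambda>y. F (m (r y))"] \<open>D \<noteq> {}\<close> by blast
  have "F (m (r y)) \<le> F z" if "z \<in> D" for z
  proof -
    have "F (m (r y)) \<le> F (m (r (k z)))"
      using y that unfolding is_arg_min_linorder by blast
    also have "\<dots> \<le> F z"
      using m(2)[of "r (k z)" z] r[of "k z"] that by simp
    finally show ?thesis .
  qed
  moreover have "m (r y) \<in> D"
    using y m(1) r unfolding is_arg_min_linorder by blast
  ultimately show ?thesis
    by blast
qed

definition relaxed_feas :: "('nx::finite, 'ny::finite) minlp \<Rightarrow> ((real ^ 'nx) \<times> (real ^ 'ny)) set" where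
  "relaxed_feas P = {z \<in> X_set P \<times> Y_bar P. constraints_ok P z}"

lemma minlp_feas_subset_relaxed_feas: "minlp_feas P \<subseteq> relaxed_feas P"
  by (auto simp: minlp_feas_def relaxed_feas_def Y_int_def)

lemma relaxed_feas_imp_nlp_feas: "(x, y) \<in> relaxed_feas P \<Longrightarrow> x \<in> nlp_feas P y"
  by (auto simp: relaxed_feas_def nlp_feas_def)

lemma nlp_opt_in_minlp_feas:
  "y \<in> Y_int P \<Longrightarrow> nlp_opt P y x \<Longrightarrow> (x, y) \<in> minlp_feas P"
  by (auto simp: nlp_opt_def is_arg_min_def minlp_feas_def nlp_feas_def)

lemma J_eq_obj:
  assumes "nlp_opt P y x"
  shows "J P y = ereal (obj P (x, y))"
proof -
  have "x \<in> nlp_feas P y" "\<And>x'. x' \<in> nlp_feas P y \<Longrightarrow> obj P (x, y) \<le> obj P (x', y)"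
    using assms by (auto simp: nlp_opt_def is_arg_min_linorder)
  then show ?thesis
    unfolding J_def by (intro antisym INF_lower2[of x] INF_greatest) auto
qed

lemma J_le_obj: "x \<in> nlp_feas P y \<Longrightarrow> J P y \<le> ereal (obj P (x, y))"
  unfolding J_def by (rule INF_lower)

lemma GDERIV_fst:
  assumes "GDERIV \<phi> (x, y) :> D"
  shows "GDERIV (\<lambda>x. \<phi> (x, y)) x :> fst D"
proof -
  have "((\<lambda>x. (x, y)) has_derivative (\<lambda>h. (h, 0))) (at x)"
    by (auto intro!: derivative_eq_intros)
  moreover have "(\<phi> has_derivative (\<lambda>h. h \<bullet> D)) (at (x, y))"
    using assms by (simp add: gderiv_def)
  ultimately have "((\<lambda>x. \<phi> (x, y)) has_derivative (\<lambda>h. (h, 0) \<bullet> D)) (at x)"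
    by (rule has_derivative_compose)
  then show ?thesis
    by (simp add: gderiv_def inner_prod_def)
qed

text \<open>The multipliers turn the linearized problem into one without constraints besides \<open>X\<close>; its
  Lagrangian is minimal at the linearization point up to the term \<open>v \<bullet> (y' - y)\<close>.\<close>

lemma gradJ_le_linz_obj:
  assumes "is_gradJ P y x v" "x' \<in> X_set P" "lin_constraints_ok P (x, y) (x', y')"
  shows "obj P (x, y) + v \<bullet> (y' - y) \<le> linz (obj P) (x, y) (x', y')"
proof -
  obtain lam mu where stat: "0 \<le> (grad_x (obj P) (x, y)
             + (\<Sum>i<n_g P. lam i *\<^sub>R grad_x (con_g P i) (x, y))
             + (\<Sum>j<n_h P. mu j *\<^sub>R grad_x (con_h P j) (x, y))) \<bullet> (x' - x)"
    and v: "v = grad_y (obj P) (x, y)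
       + (\<Sum>i<n_g P. lam i *\<^sub>R grad_y (con_g P i) (x, y))
       + (\<Sum>j<n_h P. mu j *\<^sub>R grad_y (con_h P j) (x, y))"
    and lam: "\<And>i. i < n_g P \<Longrightarrow> 0 \<le> lam i" "\<And>i. i < n_g P \<Longrightarrow> lam i * con_g P i (x, y) = 0"
    and h: "\<And>j. j < n_h P \<Longrightarrow> con_h P j (x, y) = 0"
    using assms(1,2) unfolding is_gradJ_def kkt_def constraints_ok_def by auto
  let ?d = "(x' - x, y' - y)"
  have split: "grad \<phi> (x, y) \<bullet> ?d
      = grad_x \<phi> (x, y) \<bullet> (x' - x) + grad_y \<phi> (x, y) \<bullet> (y' - y)" for \<phi>
    by (simp add: inner_prod_def)
  have "lam i * (grad (con_g P i) (x, y) \<bullet> ?d) \<le> 0" if "i < n_g P" for i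
  proof -
    have "lam i * linz (con_g P i) (x, y) (x', y') \<le> 0"
      using assms(3) lam(1) that by (intro mult_nonneg_nonpos) (auto simp: lin_constraints_ok_def)
    then show ?thesis
      using lam(2)[OF that] by (simp add: linz_def distrib_left)
  qed
  then have g_le: "(\<Sum>i<n_g P. lam i * (grad (con_g P i) (x, y) \<bullet> ?d)) \<le> 0"
    by (intro sum_nonpos) auto
  have "grad (con_h P j) (x, y) \<bullet> ?d = 0" if "j < n_h P" for j
    using assms(3) h that by (simp add: lin_constraints_ok_def linz_def)
  then have h_eq: "(\<Sum>j<n_h P. mu j * (grad (con_h P j) (x, y) \<bullet> ?d)) = 0"
    by (intro sum.neutral) auto
  have "v \<bullet> (y' - y) \<le> grad (obj P) (x, y) \<bullet> ?d
      + (\<Sum>i<n_g P. lam i * (grad (con_g P i) (x, y) \<bullet> ?d))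
      + (\<Sum>j<n_h P. mu j * (grad (con_h P j) (x, y) \<bullet> ?d))"
    using stat unfolding v
    by (simp add: split inner_add_left inner_sum_left distrib_left sum.distrib)
  then show ?thesis
    using g_le h_eq by (simp add: linz_def)
qed

section \<open>Attainment of minima for linearized problems with fixed \<open>y\<close>\<close>

lemma polyhedron_Collect_ball:
  assumes "finite K" "\<And>k. k \<in> K \<Longrightarrow> polyhedron {z. Q k z}"
  shows "polyhedron {z. \<forall>k\<in>K. Q k z}"
proof -
  have "{z. \<forall>k\<in>K. Q k z} = \<Inter>((\<lambda>k. {z. Q k z}) ` K)"
    by auto
  then show ?thesis
    using assms by auto
qed

lemma polyhedron_preimage_fst:
  fixes S :: "'a::euclidean_space set"
  assumes "polyhedron S"
  shows "polyhedron {z :: 'a \<times> 'b::euclidean_space. c + fst z \<in> S}"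
proof -
  obtain K :: "'a set set" and a b where K: "finite K" and S: "S = {x. \<forall>k\<in>K. a k \<bullet> x \<le> b k}"
    by (rule polyhedron_halfspaces[OF assms])
  have "{z :: 'a \<times> 'b. c + fst z \<in> S} = {z. \<forall>k\<in>K. (a k, 0) \<bullet> z \<le> b k - a k \<bullet> c}"
    by (simp add: S inner_prod_def inner_add_right le_diff_eq add.commute)
  then show ?thesis
    using K by (simp add: polyhedron_Collect_ball polyhedron_halfspace_le)
qed

lemma polyhedron_snd_eq: "polyhedron {z :: 'a::euclidean_space \<times> 'b::euclidean_space. snd z = y}"
proof -
  have "{z :: 'a \<times> 'b. snd z = y} = {z. \<forall>b\<in>Basis. (0, b) \<bullet> z = b \<bullet> y}"
    by (simp add: inner_prod_def euclidean_eq_iff[where 'a = 'b] inner_commute)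
  then show ?thesis
    by (simp add: polyhedron_Collect_ball polyhedron_hyperplane)
qed

text \<open>For fixed \<open>y\<close> the displacements from \<open>zb\<close> form a polyhedron
  and the objective is a convex quadratic, so the Frank--Wolfe theorem applies. \<open>Q\<close> is
  an arbitrary set, since fixing \<open>y\<close> makes membership constant. The bound on the linear
  part carries over because \<open>M\<close> is positive semidefinite.\<close>

lemma linearized_attains_min:
  fixes P :: "('nx::finite, 'ny::finite) minlp" and zb :: "(real ^ 'nx) \<times> (real ^ 'ny)"
    and Q :: "(real ^ 'ny) set" and M :: "(real ^ 'nx) \<times> (real ^ 'ny) \<Rightarrow> (real ^ 'nx) \<times> (real ^ 'ny)"
  assumes X: "polyhedron (X_set P)" and M: "sym_psd M"
  defines "D \<equiv> {z. fst z \<in> X_set P \<and> snd z \<in> Q \<and> lin_constraints_ok P zb z}"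
  defines "q \<equiv> \<lambda>z. linz (obj P) zb z + 1 / 2 * ((z - zb) \<bullet> M (z - zb))"
  assumes "w \<in> D" and bd: "\<And>z. z \<in> D \<Longrightarrow> snd z = snd w \<Longrightarrow> m \<le> linz (obj P) zb z"
  shows "\<exists>z\<in>D. snd z = snd w \<and> (\<forall>z'\<in>D. snd z' = snd w \<longrightarrow> q z \<le> q z')"
proof -
  define S where "S = {d. fst zb + fst d \<in> X_set P} \<inter> {d. snd d = snd w - snd zb}
    \<inter> {d. \<forall>i\<in>{..<n_g P}. grad (con_g P i) zb \<bullet> d \<le> - con_g P i zb}
    \<inter> {d. \<forall>j\<in>{..<n_h P}. grad (con_h P j) zb \<bullet> d = - con_h P j zb}"
  have S_iff: "d \<in> S \<longleftrightarrow> zb + d \<in> D \<and> snd (zb + d) = snd w" for d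
  proof -
    have "snd d = snd w - snd zb \<longleftrightarrow> snd (zb + d) = snd w"
      by (auto simp: eq_diff_eq add.commute)
    moreover have *: "a \<le> - b \<longleftrightarrow> b + a \<le> 0" for a b :: real
      by linarith
    moreover have "snd w \<in> Q"
      using \<open>w \<in> D\<close> by (simp add: D_def)
    moreover have "(\<forall>i\<in>{..<n_g P}. grad (con_g P i) zb \<bullet> d \<le> - con_g P i zb)
        \<and> (\<forall>j\<in>{..<n_h P}. grad (con_h P j) zb \<bullet> d = - con_h P j zb)
        \<longleftrightarrow> lin_constraints_ok P zb (zb + d)"
      unfolding lin_constraints_ok_def linz_def
      by (simp add: eq_neg_iff_add_eq_0 add.commute * Ball_def)
    ultimately show ?thesis
      by (auto simp: S_def D_def)
  qed
  have "polyhedron S"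
    unfolding S_def
    by (intro polyhedron_Int polyhedron_preimage_fst[OF X] polyhedron_snd_eq polyhedron_Collect_ball
        polyhedron_halfspace_le polyhedron_hyperplane) auto
  moreover have "S \<noteq> {}"
    using S_iff[of "w - zb"] \<open>w \<in> D\<close> by auto
  moreover have "m - obj P zb \<le> grad (obj P) zb \<bullet> d + 1 / 2 * (d \<bullet> M d)" if "d \<in> S" for d
  proof -
    have "m \<le> linz (obj P) zb (zb + d)"
      using bd that S_iff by blast
    moreover have "0 \<le> d \<bullet> M d"
      using M unfolding sym_psd_def by blast
    ultimately show ?thesis
      by (simp add: linz_def)
  qed
  ultimately have "\<exists>d\<in>S. \<forall>d'\<in>S. grad (obj P) zb \<bullet> d + 1 / 2 * (d \<bullet> M d)
      \<le> grad (obj P) zb \<bullet> d' + 1 / 2 * (d' \<bullet> M d')"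
    by (intro convex_quadratic_attains_min M)
  then obtain d where d: "d \<in> S" "\<And>d'. d' \<in> S \<Longrightarrow>
      grad (obj P) zb \<bullet> d + 1 / 2 * (d \<bullet> M d) \<le> grad (obj P) zb \<bullet> d' + 1 / 2 * (d' \<bullet> M d')"
    by blast
  have "q (zb + d) \<le> q z'" if "z' \<in> D" "snd z' = snd w" for z'
    using d(2)[of "z' - zb"] S_iff[of "z' - zb"] that by (simp add: q_def linz_def)
  then show ?thesis
    using d(1) S_iff by blast
qed

section \<open>Consequences of convexity: relaxations, multipliers and feasibility cuts\<close>

locale convex_minlp =
  fixes P :: "('nx::finite, 'ny::finite) minlp"
  assumes polyhedron_X: "polyhedron (X_set P)" and polyhedron_Y: "polyhedron (Y_bar P)"
    and obj_smooth: "twice_cont_differentiable (obj P)"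
    and con_g_smooth: "\<And>i. i < n_g P \<Longrightarrow> twice_cont_differentiable (con_g P i)"
    and finite_Y_int: "finite (Y_int P)"
    and con_h_affine: "\<And>j. j < n_h P \<Longrightarrow> affine_fun (con_h P j)"
    and con_g_convex: "\<And>i. i < n_g P \<Longrightarrow> convex_on (X_set P \<times> Y_bar P) (con_g P i)"
    and obj_convex: "convex_on (X_set P \<times> Y_bar P) (obj P)"
begin

text \<open>Tangents lie below the convex \<open>con_g\<close> and agree with the affine
  \<open>con_h\<close>, so linearizing at any point of \<open>X_set P \<times> Y_bar P\<close>
  relaxes the constraints.\<close>

lemma relaxed_feas_imp_lin_constraints_ok:
  assumes "zb \<in> X_set P \<times> Y_bar P" "z \<in> relaxed_feas P"
  shows "lin_constraints_ok P zb z"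
  unfolding lin_constraints_ok_def
proof (intro conjI allI impI)
  fix i assume i: "i < n_g P"
  have "linz (con_g P i) zb z \<le> con_g P i z"
    using assms by (intro convex_on_imp_linz_le[OF con_g_convex[OF i]]
        twice_cont_differentiable_GDERIV con_g_smooth i) (auto simp: relaxed_feas_def)
  also have "\<dots> \<le> 0"
    using assms i by (auto simp: relaxed_feas_def constraints_ok_def)
  finally show "linz (con_g P i) zb z \<le> 0" .
next
  fix j assume "j < n_h P"
  then show "linz (con_h P j) zb z = 0"
    using assms affine_fun_eq_linz[OF con_h_affine] by (auto simp: relaxed_feas_def constraints_ok_def)
qed

lemma linz_obj_le:
  assumes "zb \<in> X_set P \<times> Y_bar P" "z \<in> X_set P \<times> Y_bar P"
  shows "linz (obj P) zb z \<le> obj P z"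
  using assms by (intro convex_on_imp_linz_le[OF obj_convex] twice_cont_differentiable_GDERIV obj_smooth)

lemma convex_relaxed_feas: "convex (relaxed_feas P)"
proof -
  have eq: "relaxed_feas P = {z \<in> X_set P \<times> Y_bar P. \<forall>i<n_g P. con_g P i z \<le> 0} \<inter>
      (\<Inter>j\<in>{..<n_h P}. {z. con_h P j z = 0})"
    by (auto simp: relaxed_feas_def constraints_ok_def)
  have cvx: "convex (X_set P \<times> Y_bar P)"
    using polyhedron_X polyhedron_Y by (simp add: convex_Times polyhedron_imp_convex)
  have "convex {z \<in> X_set P \<times> Y_bar P. \<forall>i<n_g P. con_g P i z \<le> 0}"
  proof (intro convexI)
    fix z w and s t :: real
    assume z: "z \<in> {z \<in> X_set P \<times> Y_bar P. \<forall>i<n_g P. con_g P i z \<le> 0}"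
      and w: "w \<in> {z \<in> X_set P \<times> Y_bar P. \<forall>i<n_g P. con_g P i z \<le> 0}"
      and st: "0 \<le> s" "0 \<le> t" "s + t = 1"
    have "con_g P i (s *\<^sub>R z + t *\<^sub>R w) \<le> 0" if "i < n_g P" for i
    proof -
      have "con_g P i (s *\<^sub>R z + t *\<^sub>R w) \<le> s * con_g P i z + t * con_g P i w"
        using con_g_convex[OF that] z w st unfolding convex_on_def by blast
      also have "\<dots> \<le> 0"
        using z w st that by (intro add_nonpos_nonpos mult_nonneg_nonpos) auto
      finally show ?thesis .
    qed
    moreover have "s *\<^sub>R z + t *\<^sub>R w \<in> X_set P \<times> Y_bar P"
      using cvx z w st unfolding convex_def by blast
    ultimately show "s *\<^sub>R z + t *\<^sub>R w \<in> {z \<in> X_set P \<times> Y_bar P. \<forall>i<n_g P. con_g P i z \<le> 0}"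
      by blast
  qed
  moreover have "convex {z. con_h P j z = 0}" if "j < n_h P" for j
  proof -
    obtain a c where "\<And>z. con_h P j z = a \<bullet> z + c"
      using con_h_affine[OF \<open>j < n_h P\<close>] unfolding affine_fun_def by blast
    then have "{z. con_h P j z = 0} = {z. a \<bullet> z = - c}"
      by (auto simp: eq_neg_iff_add_eq_0)
    then show ?thesis
      by (simp add: convex_hyperplane)
  qed
  ultimately show ?thesis
    unfolding eq by (intro convex_Int convex_INT) auto
qed

text \<open>Lets the feasible branch of \<open>nlp_phase\<close> proceed: with \<open>y\<close>
  fixed, the constraint qualification supplies the direction for
  \<open>kkt_multipliers_exist\<close>.\<close>

lemma is_gradJ_exists:
  assumes opt: "nlp_opt P y x" and mfcq: "mfcq P y x"
  shows "\<exists>v. is_gradJ P y x v"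
proof -
  have x: "x \<in> X_set P" "constraints_ok P (x, y)"
    and min: "\<And>z. z \<in> nlp_feas P y \<Longrightarrow> obj P (x, y) \<le> obj P (z, y)"
    using opt by (auto simp: nlp_opt_def nlp_feas_def is_arg_min_linorder)
  obtain x0 where x0: "x0 \<in> X_set P" "\<And>j. j < n_h P \<Longrightarrow> grad_x (con_h P j) (x, y) \<bullet> (x0 - x) = 0"
      "\<And>i. i < n_g P \<Longrightarrow> con_g P i (x, y) = 0 \<Longrightarrow> grad_x (con_g P i) (x, y) \<bullet> (x0 - x) < 0"
    using mfcq unfolding mfcq_def by blast
  have h: "con_h P j (z, y) = con_h P j (x, y) + grad_x (con_h P j) (x, y) \<bullet> (z - x)"
    if "j < n_h P" for j z
    using affine_fun_eq_linz[OF con_h_affine[OF that], of "(x, y)" "(z, y)"]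
    by (simp add: linz_def inner_prod_def)
  have "\<exists>lam mu. (\<forall>i<n_g P. 0 \<le> lam i \<and> lam i * con_g P i (x, y) = 0) \<and>
    (\<forall>z\<in>X_set P. 0 \<le> (grad_x (obj P) (x, y)
        + (\<Sum>i<n_g P. lam i *\<^sub>R grad_x (con_g P i) (x, y))
        + (\<Sum>j<n_h P. mu j *\<^sub>R grad_x (con_h P j) (x, y))) \<bullet> (z - x))"
  proof (rule kkt_multipliers_exist[OF polyhedron_X x(1), where \<phi> = "\<lambda>x. obj P (x, y)"
        and G = "\<lambda>i x. con_g P i (x, y)" and H = "\<lambda>j x. con_h P j (x, y)"
        and p = "n_g P" and q = "n_h P" and g = "\<lambda>i. grad_x (con_g P i) (x, y)"
        and h = "\<lambda>j. grad_x (con_h P j) (x, y)"])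
    show "GDERIV (\<lambda>x. obj P (x, y)) x :> grad_x (obj P) (x, y)"
      by (intro GDERIV_fst twice_cont_differentiable_GDERIV obj_smooth)
    show "GDERIV (\<lambda>x. con_g P i (x, y)) x :> grad_x (con_g P i) (x, y)" if "i < n_g P" for i
      by (intro GDERIV_fst twice_cont_differentiable_GDERIV con_g_smooth that)
    show "con_g P i (x, y) \<le> 0" if "i < n_g P" for i
      using x(2) that by (simp add: constraints_ok_def)
    show "con_h P j (x, y) = 0" if "j < n_h P" for j
      using x(2) that by (simp add: constraints_ok_def)
    show "obj P (x, y) \<le> obj P (z, y)"
      if "z \<in> X_set P" "\<forall>i<n_g P. con_g P i (z, y) \<le> 0" "\<forall>j<n_h P. con_h P j (z, y) = 0" for z
      using that by (intro min) (simp add: nlp_feas_def constraints_ok_def)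
    show "con_h P j (z, y) = con_h P j (x, y) + grad_x (con_h P j) (x, y) \<bullet> (z - x)"
      if "j < n_h P" for j z
      using that by (rule h)
    show "x0 \<in> X_set P" by (rule x0)
    show "grad_x (con_h P j) (x, y) \<bullet> (x0 - x) = 0" if "j < n_h P" for j
      using that by (rule x0)
    show "grad_x (con_g P i) (x, y) \<bullet> (x0 - x) < 0" if "i < n_g P" "con_g P i (x, y) = 0" for i
      using that by (rule x0)
  qed
  then obtain lam mu where "\<forall>i<n_g P. 0 \<le> lam i \<and> lam i * con_g P i (x, y) = 0"
    "\<forall>z\<in>X_set P. 0 \<le> (grad_x (obj P) (x, y)
        + (\<Sum>i<n_g P. lam i *\<^sub>R grad_x (con_g P i) (x, y))
        + (\<Sum>j<n_h P. mu j *\<^sub>R grad_x (con_h P j) (x, y))) \<bullet> (z - x)"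
    by blast
  \<comment> \<open>The \<open>y\<close>-part of stationarity imposes no condition; it defines
    \<open>mu_y\<close>.\<close>
  then have "kkt P y x lam mu (- (grad_y (obj P) (x, y)
       + (\<Sum>i<n_g P. lam i *\<^sub>R grad_y (con_g P i) (x, y))
       + (\<Sum>j<n_h P. mu j *\<^sub>R grad_y (con_h P j) (x, y))))"
    using x by (simp add: kkt_def)
  then show ?thesis
    unfolding is_gradJ_def by blast
qed

text \<open>The trust region of the feasibility problem does not spoil the cut: the infeasible \<open>yh\<close>
  lies on the sphere bounding it, hence its projection \<open>p\<close> lies in the open ball, and a short
  enough step from \<open>p\<close> towards any feasible point stays in the ball.\<close>

lemma fnlp_opt_cut:
  assumes opt: "fnlp_opt P yh yb (xp, p)" and infeas: "nlp_feas P yh = {}"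
    and yb: "\<And>c. yb = Some c \<Longrightarrow> c \<in> snd ` relaxed_feas P"
  shows "p \<noteq> yh" and "\<And>z. z \<in> relaxed_feas P \<Longrightarrow> (yh - p) \<bullet> (snd z - p) \<le> 0"
proof -
  define C where "C = snd ` relaxed_feas P"
  define T where "T = (case yb of None \<Rightarrow> UNIV | Some c \<Rightarrow> cball c (norm (c - yh)))"
  have "convex C"
    unfolding C_def by (intro convex_linear_image convex_relaxed_feas linear_snd)
  have "convex T"
    by (simp add: T_def split: option.split)
  have feas_iff: "(\<exists>x. (x, y) \<in> fnlp_feas P yh yb) \<longleftrightarrow> y \<in> C \<inter> T" for y
  proof (cases yb)
    case None
    then show ?thesis
      by (auto simp: fnlp_feas_def C_def T_def relaxed_feas_def image_iff)
  next
    case (Some c)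
    have "(norm (c - y))\<^sup>2 \<le> (norm (c - yh))\<^sup>2 \<longleftrightarrow> norm (c - y) \<le> norm (c - yh)"
      by (rule power_mono_iff) auto
    then show ?thesis
      by (auto simp: Some fnlp_feas_def C_def T_def relaxed_feas_def image_iff dist_norm)
  qed
  have p: "p \<in> C" "p \<in> T" and min: "\<And>y. y \<in> C \<Longrightarrow> y \<in> T \<Longrightarrow> dist yh p \<le> dist yh y"
  proof -
    have *: "(xp, p) \<in> fnlp_feas P yh yb"
        "\<And>z. z \<in> fnlp_feas P yh yb \<Longrightarrow> (norm (p - yh))\<^sup>2 \<le> (norm (snd z - yh))\<^sup>2"
      using opt by (auto simp: fnlp_opt_def is_arg_min_linorder split_beta)
    then show "p \<in> C" "p \<in> T"
      using feas_iff by blast+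
    fix y assume "y \<in> C" "y \<in> T"
    then obtain x where "(x, y) \<in> fnlp_feas P yh yb"
      using feas_iff by blast
    from *(2)[OF this] show "dist yh p \<le> dist yh y"
      by (simp add: dist_norm norm_minus_commute)
  qed
  show "p \<noteq> yh"
    using p(1) infeas by (auto simp: C_def dest: relaxed_feas_imp_nlp_feas)
  \<comment> \<open>The variational inequality of a nearest point, applied on the segment from
    \<open>p\<close> to \<open>y\<close>, which convexity keeps in
    \<open>C \<inter> T\<close>.\<close>
  have proj: "(yh - p) \<bullet> (y - p) \<le> 0" if "y \<in> C" "y \<in> T" for y
  proof (rule any_closest_point_dot)
    have "closed_segment p y \<subseteq> C \<inter> T"
      using p that \<open>convex C\<close> \<open>convex T\<close> by (intro closed_segment_subset) (auto intro: convex_Int)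
    then show "\<forall>z\<in>closed_segment p y. dist yh p \<le> dist yh z"
      using min by blast
  qed auto
  have step: "\<exists>t. 0 < t \<and> t \<le> 1 \<and> p + t *\<^sub>R (y - p) \<in> T" for y
  proof (cases yb)
    case None
    then show ?thesis
      by (auto simp: T_def intro!: exI[of _ 1])
  next
    case (Some c)
    define r where "r = norm (c - yh)"
    have T: "T = cball c r"
      by (simp add: T_def Some r_def)
    have "c \<in> C" "c \<in> T"
      using yb[OF Some] by (auto simp: C_def T r_def)
    then have le: "(yh - p) \<bullet> (c - p) \<le> 0"
      by (rule proj)
    have "norm (c - p) < r"
    proof (rule ccontr)
      assume "\<not> norm (c - p) < r"
      then have "norm (c - yh) \<le> norm (c - p)"
        by (simp add: r_def)
      then have "(norm (c - yh))\<^sup>2 \<le> (norm (c - p))\<^sup>2"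
        by (simp add: power_mono)
      \<comment> \<open>Law of cosines at \<open>p\<close>: the inner product there is nonpositive,
        so \<open>yh\<close> is strictly farther from \<open>c\<close> than
        \<open>p\<close>.\<close>
      moreover have "(norm (c - yh))\<^sup>2 = (norm (c - p))\<^sup>2 - 2 * ((yh - p) \<bullet> (c - p)) + (norm (yh - p))\<^sup>2"
        by (simp add: power2_norm_eq_inner inner_diff_left inner_diff_right inner_commute)
      ultimately have "(norm (yh - p))\<^sup>2 \<le> 0"
        using le by linarith
      with \<open>p \<noteq> yh\<close> show False
        by simp
    qed
    \<comment> \<open>The step length that the triangle inequality allows inside the ball; adding 1
      covers \<open>y = p\<close>.\<close>
    define t where "t = min 1 ((r - norm (c - p)) / (norm (y - p) + 1))"
    have "0 < norm (y - p) + 1"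
      by (simp add: add_nonneg_pos)
    moreover have "t \<le> (r - norm (c - p)) / (norm (y - p) + 1)"
      by (simp add: t_def)
    ultimately have "t * (norm (y - p) + 1) \<le> r - norm (c - p)"
      using pos_le_divide_eq by blast
    moreover have "0 < t" "t \<le> 1"
      using \<open>norm (c - p) < r\<close> \<open>0 < norm (y - p) + 1\<close> by (simp_all add: t_def)
    ultimately have t: "0 < t" "t \<le> 1" "t * (norm (y - p) + 1) \<le> r - norm (c - p)"
      by blast+
    have "norm (c - (p + t *\<^sub>R (y - p))) \<le> norm (c - p) + t * norm (y - p)"
      using norm_triangle_ineq4[of "c - p" "t *\<^sub>R (y - p)"] t by (simp add: diff_diff_eq)
    also have "\<dots> \<le> r"
      using t by (simp add: algebra_simps)
    finally show ?thesis
      using t by (auto simp: T dist_norm)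
  qed
  fix z assume "z \<in> relaxed_feas P"
  then have "snd z \<in> C"
    by (simp add: C_def)
  obtain t where t: "0 < t" "t \<le> 1" "p + t *\<^sub>R (snd z - p) \<in> T"
    using step by blast
  have "p + t *\<^sub>R (snd z - p) = (1 - t) *\<^sub>R p + t *\<^sub>R snd z"
    by (simp add: algebra_simps)
  then have "p + t *\<^sub>R (snd z - p) \<in> C"
    using convexD_alt[OF \<open>convex C\<close> p(1) \<open>snd z \<in> C\<close>] t by simp
  \<comment> \<open>The cut holds at the shortened point; dividing by \<open>t > 0\<close> extends
    it to \<open>z\<close>, even outside the trust region.\<close>
  from proj[OF this t(3)] have "t * ((yh - p) \<bullet> (snd z - p)) \<le> 0"
    by simp
  then show "(yh - p) \<bullet> (snd z - p) \<le> 0"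
    using t(1) by (simp add: mult_le_0_iff)
qed

end

section \<open>Invariants of the algorithm\<close>

definition nlp_data_ok :: "('nx::finite, 'ny::finite) minlp \<Rightarrow> ('nx, 'ny) state \<Rightarrow> bool" where
  "nlp_data_ok P s \<longleftrightarrow> (\<forall>i\<in>T_set s. ypt s i \<in> Y_int P \<and> nlp_opt P (ypt s i) (xpt s i) \<and>
     is_gradJ P (ypt s i) (xpt s i) (gJ s i))"

definition S_cuts_valid :: "('nx::finite, 'ny::finite) minlp \<Rightarrow> ('nx, 'ny) state \<Rightarrow> bool" where
  "S_cuts_valid P s \<longleftrightarrow> (\<forall>i\<in>S_set s. ybar s i \<noteq> ypt s i) \<and> (\<forall>z\<in>relaxed_feas P. S_cuts_ok s (snd z))"

text \<open>The last conjunct guarantees that FNLP has a feasible point as long as the loop runs,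
  even when no feasible integer point is known.\<close>

definition bounds_ok :: "('nx::finite, 'ny::finite) minlp \<Rightarrow> ('nx, 'ny) state \<Rightarrow> bool" where
  "bounds_ok P s \<longleftrightarrow> UB s = (INF i\<in>T_set s. J P (ypt s i)) \<and>
     (\<forall>z\<in>minlp_feas P. LB s \<le> ereal (obj P z)) \<and> (LB s < \<infinity> \<longrightarrow> relaxed_feas P \<noteq> {})"

definition best_ok :: "('nx::finite, 'ny::finite) minlp \<Rightarrow> ('nx, 'ny) state \<Rightarrow> bool" where
  "best_ok P s \<longleftrightarrow> (T_set s \<noteq> {} \<longrightarrow>
     best s \<in> T_set s \<and> (\<forall>i\<in>T_set s. J P (ypt s (best s)) \<le> J P (ypt s i)))"

text \<open>\<open>N\<close> is the number of points processed: \<open>iter s\<close> before and \<open>Suc (iter s)\<close> after steps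
  (i) and (ii).\<close>

definition wf_state :: "('nx::finite, 'ny::finite) minlp \<Rightarrow> nat \<Rightarrow> ('nx, 'ny) state \<Rightarrow> bool" where
  "wf_state P N s \<longleftrightarrow> T_set s \<union> S_set s = {..<N} \<and> ypt s ` {..iter s} \<subseteq> Y_int P \<and>
     nlp_data_ok P s \<and> S_cuts_valid P s \<and> bounds_ok P s \<and> best_ok P s"

lemma is_arg_min_Least:
  fixes f :: "nat \<Rightarrow> 'a::order"
  assumes "finite S" "S \<noteq> {}"
  shows "is_arg_min f (\<lambda>i. i \<in> S) (LEAST i. is_arg_min f (\<lambda>i. i \<in> S) i)"
  using ex_is_arg_min_if_finite[OF assms, of f] by (auto intro: LeastI)

lemma best_ok_set_best:
  assumes "finite (T_set s)"
  shows "best_ok P (set_best P s)"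
proof -
  have "is_arg_min (\<lambda>i. J P (ypt s i)) (\<lambda>i. i \<in> T_set s) (best (set_best P s))" if "T_set s \<noteq> {}"
    using is_arg_min_Least[OF assms that] that by (simp add: set_best_def best_index_def)
  then show ?thesis
    unfolding is_arg_min_linorder by (auto simp: best_ok_def set_best_def)
qed

context
  fixes P :: "('nx::finite, 'ny::finite) minlp" and s :: "('nx, 'ny) state" and N :: nat
  assumes wf: "wf_state P N s"
begin

lemma wf_T_empty_UB: "T_set s = {} \<Longrightarrow> UB s = \<infinity>"
  using wf by (simp add: wf_state_def bounds_ok_def top_ereal_def)

lemma wf_best:
  assumes "T_set s \<noteq> {}"
  shows "best s \<in> T_set s" "nlp_opt P (ypt s (best s)) (xpt s (best s))"
    "is_gradJ P (ypt s (best s)) (xpt s (best s)) (gJ s (best s))"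
    "ypt s (best s) \<in> Y_int P" "incumbent s \<in> minlp_feas P"
    "UB s = J P (ypt s (best s))" "UB s = ereal (obj P (incumbent s))"
proof -
  show *: "best s \<in> T_set s" "nlp_opt P (ypt s (best s)) (xpt s (best s))"
    "is_gradJ P (ypt s (best s)) (xpt s (best s)) (gJ s (best s))" "ypt s (best s) \<in> Y_int P"
    using wf assms by (auto simp: wf_state_def nlp_data_ok_def best_ok_def)
  show "incumbent s \<in> minlp_feas P"
    unfolding incumbent_def by (intro nlp_opt_in_minlp_feas *)
  have "(INF i\<in>T_set s. J P (ypt s i)) = J P (ypt s (best s))"
    using wf assms by (intro antisym INF_lower INF_greatest *) (auto simp: wf_state_def best_ok_def)
  then show "UB s = J P (ypt s (best s))"
    using wf by (simp add: wf_state_def bounds_ok_def)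
  then show "UB s = ereal (obj P (incumbent s))"
    by (simp add: incumbent_def J_eq_obj[OF *(2)])
qed

lemma wf_UB_le: "i \<in> T_set s \<Longrightarrow> UB s \<le> J P (ypt s i)"
  using wf by (auto simp: wf_state_def bounds_ok_def intro: INF_lower)

lemma wf_J_finite: "i \<in> T_set s \<Longrightarrow> J P (ypt s i) = ereal (obj P (xpt s i, ypt s i))"
  using wf by (auto simp: wf_state_def nlp_data_ok_def intro: J_eq_obj)

text \<open>At \<open>ypt s i\<close> the cut reads: squared distance to \<open>ybar s i\<close> at
  most 0, yet the two points differ.\<close>

lemma wf_S_cut_off:
  assumes "S_cuts_ok s y" "i \<in> S_set s"
  shows "y \<noteq> ypt s i"
proof
  assume "y = ypt s i"
  then have "(ypt s i - ybar s i) \<bullet> (ypt s i - ybar s i) \<le> 0"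
    using assms by (auto simp: S_cuts_ok_def)
  then have "ypt s i = ybar s i"
    by (metis antisym inner_eq_zero_iff inner_ge_zero right_minus_eq)
  then show False
    using wf assms(2) by (auto simp: wf_state_def S_cuts_valid_def)
qed

text \<open>Serves twice: for fixed \<open>y\<close> it bounds the linear model from below, which
  gives attainment; at the incumbent's \<open>y\<close> it shows that the model cannot fall below
  the incumbent value.\<close>

lemma wf_linz_obj_ge:
  assumes "T_set s \<noteq> {}" "fst z \<in> X_set P" "lin_constraints_ok P (incumbent s) z"
  shows "obj P (incumbent s) + gJ s (best s) \<bullet> (snd z - ypt s (best s)) \<le> linz (obj P) (incumbent s) z"
  using gradJ_le_linz_obj[OF wf_best(3)[OF assms(1)], of "fst z" "snd z"] assms
  by (simp add: incumbent_def)

end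

text \<open>The objective of LB-MILP after elimination of \<open>\<eta>\<close>.\<close>

definition lb_value :: "('nx::finite, 'ny::finite) minlp \<Rightarrow> ('nx, 'ny) state \<Rightarrow>
    (real ^ 'nx) \<times> (real ^ 'ny) \<Rightarrow> real" where
  "lb_value P s z = Max (insert (linz (obj P) (incumbent s) z)
     ((\<lambda>i. obj P (xpt s i, ypt s i) + gJ s i \<bullet> (snd z - ypt s i)) ` (T_set s - {best s})))"

lemma lb_feas_iff:
  assumes "wf_state P N s" "T_set s \<noteq> {}"
  shows "(\<eta>, z) \<in> lb_feas P s \<longleftrightarrow> z \<in> {z. fst z \<in> X_set P \<and> snd z \<in> {y \<in> Y_int P. S_cuts_ok s y} \<and>
    lin_constraints_ok P (incumbent s) z} \<and> lb_value P s z \<le> \<eta>"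
proof -
  have "finite (T_set s)"
    using assms(1) by (metis finite_Un finite_lessThan wf_state_def)
  then show ?thesis
    using wf_best(1)[OF assms] wf_J_finite[OF assms(1)]
    by (cases z) (auto simp: lb_feas_def lb_value_def J_cut_def)
qed

lemma feasible_best_y_relaxed:
  assumes "wf_state P N s" "feasible_best_y s = Some c"
  shows "c \<in> snd ` relaxed_feas P"
proof -
  have "T_set s \<noteq> {}" "c = snd (incumbent s)"
    using assms(2) by (auto simp: feasible_best_y_def incumbent_def split: if_splits)
  then show ?thesis
    using wf_best(5)[OF assms(1)] minlp_feas_subset_relaxed_feas by blast
qed

text \<open>An incumbent is itself feasible, its \<open>y\<close> being the centre of the trust
  region; without one, the invariant on \<open>LB\<close> provides a relaxed point.\<close>

lemma fnlp_feas_nonempty: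
  assumes wf: "wf_state P N s" and "LB s < UB s"
  shows "fnlp_feas P y (feasible_best_y s) \<noteq> {}"
proof (cases "T_set s = {}")
  case True
  have "LB s < \<infinity>"
    using assms(2) by (rule order_less_le_trans) simp
  then have "relaxed_feas P \<noteq> {}"
    using wf by (simp add: wf_state_def bounds_ok_def)
  then show ?thesis
    using True by (auto simp: feasible_best_y_def relaxed_feas_def fnlp_feas_def)
next
  case False
  then have "incumbent s \<in> relaxed_feas P"
    using wf_best(5)[OF wf] minlp_feas_subset_relaxed_feas by blast
  then have "incumbent s \<in> fnlp_feas P y (feasible_best_y s)"
    using False by (auto simp: feasible_best_y_def relaxed_feas_def fnlp_feas_def incumbent_def)
  then show ?thesis
    by blast
qed

lemma nlp_phase_frame:
  "nlp_phase P s s1 \<Longrightarrow> iter s1 = iter s \<and> ypt s1 = ypt s \<and> LB s1 = LB s"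
  by (cases rule: nlp_phase.cases) (auto simp: set_best_def)

text \<open>Index \<open>Suc (iter s)\<close> lies outside \<open>T_set s \<union> S_set s\<close>,
  so the new point disturbs no processed data, and only the new lower bound needs
  justification.\<close>

lemma wf_state_advance:
  assumes wf: "wf_state P (Suc (iter s)) s" and "y \<in> Y_int P"
    and LB: "\<And>z. z \<in> minlp_feas P \<Longrightarrow> V \<le> ereal (obj P z)" "LB s \<le> V"
  shows "wf_state P (Suc (iter s)) (advance y (s\<lparr>LB := V\<rparr>))"
proof -
  have TS: "T_set s \<union> S_set s = {..<Suc (iter s)}"
    using wf by (simp add: wf_state_def)
  let ?y = "(ypt s)(Suc (iter s) := y)"
  have y: "?y i = ypt s i" if "i \<in> T_set s \<or> i \<in> S_set s" for i
    using TS that by (metis Un_iff fun_upd_apply lessThan_iff less_irrefl)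
  have "T_set s \<noteq> {} \<Longrightarrow> best s \<in> T_set s"
    by (rule wf_best(1)[OF wf])
  moreover have "?y ` {..Suc (iter s)} \<subseteq> Y_int P"
    using wf \<open>y \<in> Y_int P\<close> by (auto simp: wf_state_def)
  moreover have "(INF i\<in>T_set s. J P (?y i)) = (INF i\<in>T_set s. J P (ypt s i))"
    using y by (intro INF_cong) auto
  moreover have "LB s < \<infinity>" if "V < \<infinity>"
    using LB(2) that by (rule order_le_less_trans)
  ultimately show ?thesis
    using wf y LB(1) unfolding wf_state_def nlp_data_ok_def S_cuts_valid_def S_cuts_ok_def
      bounds_ok_def best_ok_def advance_def
    by auto
qed

text \<open>The only use of \<open>\<alpha> < 1\<close>: before the bounds meet, BR-MIQP cannot propose a point whose NLP was
  solved already.\<close>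

lemma Jbar_less_UB:
  assumes "wf_state P N s" "T_set s \<noteq> {}" "LB s < UB s" "0 \<le> \<alpha>" "\<alpha> < 1"
  shows "Jbar P \<alpha> s < UB s"
proof -
  define r where "r = obj P (incumbent s)"
  have UB: "UB s = ereal r" and J: "J P (ypt s (best s)) = ereal r"
    using wf_best(6,7)[OF assms(1,2)] by (simp_all add: r_def)
  show ?thesis
  proof (cases "LB s")
    case (real l)
    then have "(1 - \<alpha>) * l < (1 - \<alpha>) * r"
      using assms UB by simp
    then show ?thesis
      by (simp add: Jbar_def J UB real algebra_simps)
  next
    case PInf
    then show ?thesis
      using assms(3) by simp
  next
    \<comment> \<open>\<open>LB\<close> may be \<open>-\<infinity>\<close> for an unbounded
      relaxation; the positive weight \<open>1 - \<alpha>\<close> then makes \<open>Jbar\<close>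
      equal to \<open>-\<infinity>\<close>.\<close>
    case MInf
    then show ?thesis
      using assms(5) by (simp add: Jbar_def J UB)
  qed
qed

lemma initial_state_wf:
  assumes "initial_state P s"
  shows "wf_state P (iter s) s"
proof -
  have LB: "LB s = (INF y\<in>Y_bar P. J P y)"
    using assms by (simp add: initial_state_def)
  have "LB s \<le> ereal (obj P z)" if "z \<in> minlp_feas P" for z
  proof -
    have "snd z \<in> Y_bar P" "fst z \<in> nlp_feas P (snd z)"
      using that by (auto simp: minlp_feas_def Y_int_def nlp_feas_def)
    then show ?thesis
      unfolding LB using J_le_obj by (intro INF_lower2[of "snd z"]) force+
  qed
  moreover have "relaxed_feas P \<noteq> {}" if "LB s < \<infinity>"
  proof -
    have "\<exists>y\<in>Y_bar P. J P y < \<infinity>"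
      using that unfolding LB INF_less_iff .
    then obtain y where y: "y \<in> Y_bar P" "J P y < \<infinity>"
      by blast
    moreover have "\<exists>x\<in>nlp_feas P y. ereal (obj P (x, y)) < \<infinity>"
      using y(2) unfolding J_def INF_less_iff .
    then obtain x where "x \<in> nlp_feas P y"
      by blast
    ultimately have "(x, y) \<in> relaxed_feas P"
      by (auto simp: nlp_feas_def relaxed_feas_def)
    then show ?thesis
      by blast
  qed
  ultimately show ?thesis
    using assms by (auto simp: wf_state_def initial_state_def nlp_data_ok_def S_cuts_valid_def
        S_cuts_ok_def bounds_ok_def best_ok_def top_ereal_def)
qed

text \<open>Once the bounds have met, \<open>UB \<le> LB\<close> lies below every feasible value, so
  an incumbent is optimal. Without an incumbent \<open>UB\<close>, and hence \<open>LB\<close>, is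
  \<open>\<infinity>\<close>, which leaves no feasible point.\<close>

lemma terminal_correct:
  assumes wf: "wf_state P N s" and "\<not> LB s < UB s"
  shows "returns_global_optimum P s \<or> returns_infeasibility_certificate P s"
proof -
  have LB: "LB s \<le> ereal (obj P z)" if "z \<in> minlp_feas P" for z
    using wf that by (auto simp: wf_state_def bounds_ok_def)
  show ?thesis
  proof (cases "T_set s = {}")
    case True
    then have "UB s = \<infinity>"
      by (rule wf_T_empty_UB[OF wf])
    moreover from this have "LB s = \<infinity>"
      using assms(2) by auto
    ultimately show ?thesis
      using LB by (auto simp: returns_infeasibility_certificate_def)
  next
    case False
    note inc = wf_best(5,7)[OF wf False]
    have "obj P (incumbent s) \<le> obj P z" if "z \<in> minlp_feas P" for z
    proof -
      have "ereal (obj P (incumbent s)) \<le> LB s"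
        using assms(2) inc(2) by simp
      also have "\<dots> \<le> ereal (obj P z)"
        by (rule LB[OF that])
      finally show ?thesis
        by simp
    qed
    then show ?thesis
      using inc by (simp add: returns_global_optimum_def minlp_opt_def is_arg_min_linorder)
  qed
qed

section \<open>Valid optimality cuts and preservation of the invariants\<close>

context convex_minlp
begin

text \<open>Validity of the optimality cut on the entire relaxation: the Lagrangian bound on the
  linear model, followed by convexity of the objective.\<close>

lemma is_gradJ_le_obj:
  assumes "is_gradJ P y x v" "(x, y) \<in> X_set P \<times> Y_bar P" "z \<in> relaxed_feas P"
  shows "obj P (x, y) + v \<bullet> (snd z - y) \<le> obj P z"
proof -
  have "lin_constraints_ok P (x, y) z" and z: "z \<in> X_set P \<times> Y_bar P"
    using relaxed_feas_imp_lin_constraints_ok assms by (auto simp: relaxed_feas_def)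
  then have "obj P (x, y) + v \<bullet> (snd z - y) \<le> linz (obj P) (x, y) z"
    using gradJ_le_linz_obj[OF assms(1), of "fst z" "snd z"] by auto
  also have "\<dots> \<le> obj P z"
    using linz_obj_le assms(2) z by blast
  finally show ?thesis .
qed

text \<open>LB-MILP is a relaxation: taking the true objective as \<open>\<eta>\<close> satisfies
  every cut. Hence its value is a lower bound, and its infeasibility proves the MINLP
  infeasible.\<close>

lemma minlp_feas_imp_lb_feas:
  assumes wf: "wf_state P N s" and z: "z \<in> minlp_feas P"
  shows "(obj P z, z) \<in> lb_feas P s"
proof -
  have zr: "z \<in> relaxed_feas P" and zY: "fst z \<in> X_set P" "snd z \<in> Y_int P" "z \<in> X_set P \<times> Y_bar P"
    using z minlp_feas_subset_relaxed_feas by (auto simp: minlp_feas_def Y_int_def)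
  have cuts: "S_cuts_ok s (snd z)"
    using wf zr by (auto simp: wf_state_def S_cuts_valid_def)
  have T: "(xpt s i, ypt s i) \<in> X_set P \<times> Y_bar P" "is_gradJ P (ypt s i) (xpt s i) (gJ s i)"
    if "i \<in> T_set s" for i
    using wf that nlp_opt_in_minlp_feas[of "ypt s i" P "xpt s i"]
    by (auto simp: wf_state_def nlp_data_ok_def minlp_feas_def Y_int_def)
  have "J_cut P s i (snd z) \<le> ereal (obj P z)" if "i \<in> T_set s" for i
    using is_gradJ_le_obj[OF T(2)[OF that] T(1)[OF that] zr] wf_J_finite[OF wf that]
    by (simp add: J_cut_def)
  moreover have "linz (obj P) (incumbent s) z \<le> obj P z \<and> lin_constraints_ok P (incumbent s) z"
    if "best s \<in> T_set s"
    using T(1)[OF that] linz_obj_le relaxed_feas_imp_lin_constraints_ok zr zY(3)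
    by (simp add: incumbent_def)
  ultimately show ?thesis
    using zY cuts by (cases z) (auto simp: lb_feas_def)
qed

lemma nlp_phase_wf:
  assumes "nlp_phase P s s1" and wf: "wf_state P (iter s) s"
  shows "wf_state P (Suc (iter s)) s1"
  using assms(1)
proof cases
  case (feasible x v)
  let ?s = "s\<lparr>T_set := insert (iter s) (T_set s), xpt := (xpt s)(iter s := x),
    gJ := (gJ s)(iter s := v), UB := (if J P (cur_y s) < UB s then J P (cur_y s) else UB s)\<rparr>"
  have TS: "T_set s \<union> S_set s = {..<iter s}"
    using wf by (simp add: wf_state_def)
  then have "finite (T_set s)"
    by (metis finite_Un finite_lessThan)
  then have "best_ok P (set_best P ?s)"
    by (intro best_ok_set_best) simp
  moreover have "iter s \<notin> T_set s"
    using TS by blast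
  then have "nlp_data_ok P (set_best P ?s)"
    using wf feasible by (auto simp: wf_state_def nlp_data_ok_def set_best_def)
  moreover have "bounds_ok P (set_best P ?s)"
    using wf by (auto simp: wf_state_def bounds_ok_def set_best_def inf_min min_def)
  moreover have "S_cuts_valid P (set_best P ?s)"
    using wf by (auto simp: wf_state_def S_cuts_valid_def S_cuts_ok_def set_best_def)
  moreover have "insert (iter s) (T_set s) \<union> S_set s = {..<Suc (iter s)}"
    by (simp add: TS lessThan_Suc)
  moreover have "ypt s ` {..iter s} \<subseteq> Y_int P"
    using wf by (simp add: wf_state_def)
  ultimately show ?thesis
    unfolding feasible(1) by (simp add: wf_state_def set_best_def)
next
  case (infeasible x yb)
  let ?s = "s\<lparr>S_set := insert (iter s) (S_set s), xpt := (xpt s)(iter s := x),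
    ybar := (ybar s)(iter s := yb)\<rparr>"
  have TS: "T_set s \<union> S_set s = {..<iter s}"
    using wf by (simp add: wf_state_def)
  then have "finite (T_set s)"
    by (metis finite_Un finite_lessThan)
  then have "best_ok P (set_best P ?s)"
    by (intro best_ok_set_best) simp
  moreover have "iter s \<notin> T_set s" "iter s \<notin> S_set s"
    using TS by blast+
  then have "nlp_data_ok P (set_best P ?s)"
    using wf by (auto simp: wf_state_def nlp_data_ok_def set_best_def)
  moreover have "bounds_ok P (set_best P ?s)"
    using wf by (auto simp: wf_state_def bounds_ok_def set_best_def)
  moreover have "S_cuts_valid P (set_best P ?s)"
    using wf \<open>iter s \<notin> S_set s\<close>
      fnlp_opt_cut[OF infeasible(3,2) feasible_best_y_relaxed[OF wf]]
    by (auto simp: wf_state_def S_cuts_valid_def S_cuts_ok_def set_best_def)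
  moreover have "T_set s \<union> insert (iter s) (S_set s) = {..<Suc (iter s)}"
    by (simp add: TS lessThan_Suc)
  moreover have "ypt s ` {..iter s} \<subseteq> Y_int P"
    using wf by (simp add: wf_state_def)
  ultimately show ?thesis
    unfolding infeasible(1) by (simp add: wf_state_def set_best_def)
qed

text \<open>Condenses the three master outcomes to a next point \<open>y\<close> and a lower bound
  \<open>V\<close>. The last clause drives termination: unless the bounds meet, \<open>y\<close> is
  new.\<close>

lemma master_phase_cases:
  assumes "master_phase P \<alpha> M s s'" and wf: "wf_state P (Suc (iter s)) s"
    and \<alpha>: "0 \<le> \<alpha>" "\<alpha> < 1"
  obtains y V where "s' = advance y (s\<lparr>LB := V\<rparr>)" "y \<in> Y_int P" "LB s \<le> V"
    "\<And>z. z \<in> minlp_feas P \<Longrightarrow> V \<le> ereal (obj P z)"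
    "V < UB s \<Longrightarrow> y \<notin> ypt s ` {..iter s}"
proof -
  have LB: "LB s \<le> ereal (obj P z)" if "z \<in> minlp_feas P" for z
    using wf that by (auto simp: wf_state_def bounds_ok_def)
  have TS: "T_set s \<union> S_set s = {..iter s}"
    using wf by (auto simp: wf_state_def lessThan_Suc_atMost)
  show ?thesis
    using assms(1)
  proof cases
    case (br x y)
    have feas: "(x, y) \<in> br_feas P \<alpha> s"
      using br(3) by (simp add: br_opt_def is_arg_min_def)
    then have y: "y \<in> Y_int P" "S_cuts_ok s y" and cuts: "\<And>i. i \<in> T_set s \<Longrightarrow> J_cut P s i y \<le> Jbar P \<alpha> s"
      by (auto simp: br_feas_def)
    have "y \<notin> ypt s ` {..iter s}" if "LB s < UB s"
    proof
      assume "y \<in> ypt s ` {..iter s}"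
      \<comment> \<open>Feasibility cuts rule out a repetition from \<open>S_set\<close>, so a
        repeated point stems from \<open>T_set\<close>.\<close>
      then obtain i where i: "i \<in> T_set s" "y = ypt s i"
        using TS wf_S_cut_off[OF wf y(2)] by (metis UnE imageE)
      then have "J P (ypt s i) \<le> Jbar P \<alpha> s"
        using cuts[of i] by (simp add: J_cut_def zero_ereal_def[symmetric])
      also have "\<dots> < UB s"
        using Jbar_less_UB[OF wf _ that \<alpha>] i by blast
      also have "\<dots> \<le> J P (ypt s i)"
        by (rule wf_UB_le[OF wf i(1)])
      finally show False
        by simp
    qed
    then show ?thesis
      using br(1) y LB that[of y "LB s"] by simp
  next
    \<comment> \<open>\<open>V = \<infinity>\<close> is a valid bound because nothing is feasible,
      and it makes the novelty clause vacuous for the retained \<open>y\<close>.\<close>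
    case lb_infeasible
    have "minlp_feas P = {}"
      using minlp_feas_imp_lb_feas[OF wf] lb_infeasible by blast
    moreover have "cur_y s \<in> Y_int P"
      using wf by (auto simp: wf_state_def)
    ultimately show ?thesis
      using lb_infeasible(1) that[of "cur_y s" \<infinity>] by simp
  next
    case (lb V x y)
    let ?V = "if LB s < V then V else LB s"
    obtain \<eta> where feas: "(\<eta>, x, y) \<in> lb_feas P s" and V: "T_set s \<noteq> {} \<Longrightarrow> V = ereal \<eta>"
      using lb(3) by (auto simp: lb_opt_def is_arg_min_def split: if_splits)
    have y: "y \<in> Y_int P" "S_cuts_ok s y"
      using feas by (auto simp: lb_feas_def)
    have "V \<le> ereal (obj P z)" if "z \<in> minlp_feas P" for z
    proof (cases "T_set s = {}")
      case True
      then show ?thesis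
        using lb(3) by (simp add: lb_opt_def)
    next
      case False
      then obtain \<zeta> where \<zeta>: "V = ereal \<zeta>" "is_arg_min fst (\<lambda>w. w \<in> lb_feas P s) (\<zeta>, x, y)"
        using lb(3) by (auto simp: lb_opt_def)
      then have "\<zeta> \<le> obj P z"
        using minlp_feas_imp_lb_feas[OF wf that] unfolding is_arg_min_linorder by (metis fst_conv)
      then show ?thesis
        by (simp add: \<zeta>(1))
    qed
    then have bound: "?V \<le> ereal (obj P z)" if "z \<in> minlp_feas P" for z
      using LB that by simp
    have new: "y \<notin> ypt s ` {..iter s}" if "?V < UB s"
    proof
      assume "y \<in> ypt s ` {..iter s}"
      then obtain i where i: "i \<in> T_set s" "y = ypt s i"
        using TS wf_S_cut_off[OF wf y(2)] by (metis UnE imageE)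
      then have T: "T_set s \<noteq> {}"
        by blast
      have "UB s \<le> ereal \<eta>"
      \<comment> \<open>LB-MILP has no \<open>J_cut\<close> at the best index; the linear model
        together with the incumbent's multipliers takes its place.\<close>
      proof (cases "i = best s")
        case True
        have "obj P (incumbent s) \<le> linz (obj P) (incumbent s) (x, y)"
          using wf_linz_obj_ge[OF wf T, of "(x, y)"] feas wf_best(1)[OF wf T] i(2) True
          by (auto simp: lb_feas_def)
        also have "\<dots> \<le> \<eta>"
          using feas wf_best(1)[OF wf T] by (auto simp: lb_feas_def)
        finally show ?thesis
          by (simp add: wf_best(7)[OF wf T])
      next
        case False
        then have "J_cut P s i y \<le> ereal \<eta>"
          using feas i by (auto simp: lb_feas_def)
        then show ?thesis
          using wf_UB_le[OF wf i(1)] i(2) by (simp add: J_cut_def zero_ereal_def[symmetric])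
      qed
      then show False
        using V[OF T] that by (auto split: if_splits)
    qed
    have "LB s \<le> ?V"
      by (auto intro: less_imp_le)
    from that[OF lb(1) y(1) this bound new] show ?thesis .
  qed
qed

lemma sbmiqp_step_cases:
  assumes "sbmiqp_step P \<alpha> B s s'" and wf: "wf_state P (iter s) s" and \<alpha>: "0 \<le> \<alpha>" "\<alpha> < 1"
  shows "wf_state P (iter s') s'" "iter s' = Suc (iter s)" "\<And>i. i \<le> iter s \<Longrightarrow> ypt s' i = ypt s i"
    "LB s' < UB s' \<Longrightarrow> ypt s' (iter s') \<notin> ypt s ` {..iter s}"
proof -
  obtain s1 where s1: "nlp_phase P s s1" "master_phase P \<alpha> (B s1) s1 s'"
    using assms(1) unfolding sbmiqp_step_def by blast
  have frame: "iter s1 = iter s" "ypt s1 = ypt s"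
    using nlp_phase_frame[OF s1(1)] by auto
  have wf1: "wf_state P (Suc (iter s1)) s1"
    using nlp_phase_wf[OF s1(1) wf] frame by simp
  obtain y V where s': "s' = advance y (s1\<lparr>LB := V\<rparr>)" "y \<in> Y_int P" "LB s1 \<le> V"
    "\<And>z. z \<in> minlp_feas P \<Longrightarrow> V \<le> ereal (obj P z)"
    "V < UB s1 \<Longrightarrow> y \<notin> ypt s1 ` {..iter s1}"
    by (rule master_phase_cases[OF s1(2) wf1 \<alpha>]) blast
  show "wf_state P (iter s') s'"
    using wf_state_advance[OF wf1 s'(2,4,3)] by (simp add: s'(1)) (simp add: advance_def)
  show "iter s' = Suc (iter s)" "\<And>i. i \<le> iter s \<Longrightarrow> ypt s' i = ypt s i"
    by (simp_all add: s'(1) advance_def frame)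
  show "ypt s' (iter s') \<notin> ypt s ` {..iter s}" if "LB s' < UB s'"
    using s'(5) that by (simp add: s'(1) advance_def frame)
qed

lemma reachable_wf:
  assumes "reachable P \<alpha> B s" "0 \<le> \<alpha>" "\<alpha> < 1"
  shows "wf_state P (iter s) s"
proof -
  obtain s0 where "initial_state P s0" "(sbmiqp_step P \<alpha> B)\<^sup>*\<^sup>* s0 s"
    using assms(1) unfolding reachable_def by blast
  from this(2) show ?thesis
    by (induction rule: rtranclp_induct)
      (use initial_state_wf[OF \<open>initial_state P s0\<close>] sbmiqp_step_cases(1) assms in blast)+
qed

section \<open>Finite termination\<close>

text \<open>Pigeonhole: along a run the points visited up to step \<open>n\<close> are distinct
  elements of \<open>Y_int P\<close>.\<close>

lemma no_infinite_run:
  assumes "0 \<le> \<alpha>" "\<alpha> < 1" "initial_state P (\<sigma> 0)" and step: "\<And>n. sbmiqp_step P \<alpha> B (\<sigma> n) (\<sigma> (Suc n))"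
  shows False
proof -
  have wf: "wf_state P (iter (\<sigma> n)) (\<sigma> n)" for n
    by (induction n) (use initial_state_wf assms sbmiqp_step_cases(1) in blast)+
  note step_cases = sbmiqp_step_cases[OF step wf assms(1,2)]
  have iter: "iter (\<sigma> n) = n" for n
    using assms(3) by (induction n) (simp_all add: step_cases(2) initial_state_def)
  have "inj_on (ypt (\<sigma> n)) {..n}" for n
  proof (induction n)
    case 0
    then show ?case by simp
  next
    case (Suc n)
    have eq: "ypt (\<sigma> (Suc n)) i = ypt (\<sigma> n) i" if "i \<le> n" for i
      using step_cases(3)[of i n] that iter by simp
    \<comment> \<open>The next step is taken, so the bounds have not met and the proposed point is
      new.\<close>
    have "LB (\<sigma> (Suc n)) < UB (\<sigma> (Suc n))"
      using step[of "Suc n"] by (simp add: sbmiqp_step_def)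
    then have "ypt (\<sigma> (Suc n)) (Suc n) \<notin> ypt (\<sigma> n) ` {..n}"
      using step_cases(4)[of n] iter by simp
    moreover have "ypt (\<sigma> (Suc n)) ` {..n} = ypt (\<sigma> n) ` {..n}"
      using eq by (intro image_cong) auto
    moreover have "inj_on (ypt (\<sigma> (Suc n))) {..n}"
      using Suc eq by (simp add: inj_on_def)
    ultimately show ?case
      by (auto simp: atMost_Suc)
  qed
  moreover have "ypt (\<sigma> n) ` {..n} \<subseteq> Y_int P" for n
    using wf[of n] iter by (simp add: wf_state_def)
  ultimately have "card {..n} \<le> card (Y_int P)" for n :: nat
    by (rule card_inj_on_le[OF _ _ finite_Y_int])
  \<comment> \<open>The index set \<open>{..n}\<close> has \<open>Suc n\<close> elements, one too
    many for \<open>n = card (Y_int P)\<close>.\<close>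
  from this[of "card (Y_int P)"] show False
    by simp
qed

section \<open>Solvability of the subproblems\<close>

text \<open>The J-cuts and feasibility cuts involve \<open>y\<close> only and go into the finite
  \<open>Q\<close>. On each fibre the linear model is bounded by the multipliers stored for the
  incumbent, which is where \<open>T_set s \<noteq> {}\<close> enters.\<close>

lemma br_opt_exists:
  assumes wf: "wf_state P N s" and T: "T_set s \<noteq> {}" and "br_feas P \<alpha> s \<noteq> {}" and M: "sym_psd M"
  shows "\<exists>z. br_opt P \<alpha> M s z"
proof -
  define Q where "Q = {y \<in> Y_int P. (\<forall>i\<in>T_set s. J_cut P s i y \<le> Jbar P \<alpha> s) \<and> S_cuts_ok s y}"
  define q where "q = (\<lambda>z. linz (obj P) (incumbent s) z + 1 / 2 * ((z - incumbent s) \<bullet> M (z - incumbent s)))"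
  have eq: "br_feas P \<alpha> s = {z. fst z \<in> X_set P \<and> snd z \<in> Q \<and> lin_constraints_ok P (incumbent s) z}"
    by (auto simp: br_feas_def Q_def)
  have "\<exists>z\<in>br_feas P \<alpha> s. \<forall>z'\<in>br_feas P \<alpha> s. q z \<le> q z'"
  proof (rule finite_fibres_attain_min)
    show "finite Q"
      using finite_Y_int by (simp add: Q_def)
    show "snd ` br_feas P \<alpha> s \<subseteq> Q"
      by (auto simp: eq)
    fix w assume w: "w \<in> br_feas P \<alpha> s"
    have "\<exists>z\<in>br_feas P \<alpha> s. snd z = snd w \<and> (\<forall>z'\<in>br_feas P \<alpha> s. snd z' = snd w \<longrightarrow> q z \<le> q z')"
      unfolding eq q_def
      by (rule linearized_attains_min[OF polyhedron_X M, where
            m = "obj P (incumbent s) + gJ s (best s) \<bullet> (snd w - ypt s (best s))"])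
        (use w wf_linz_obj_ge[OF wf T] in \<open>auto simp: eq\<close>)
    then show "\<exists>z\<in>br_feas P \<alpha> s. \<forall>z'\<in>br_feas P \<alpha> s. snd z' = snd w \<longrightarrow> q z \<le> q z'"
      by blast
  qed fact
  then show ?thesis
    unfolding br_opt_def is_arg_min_linorder q_def by blast
qed

text \<open>On a fibre the J-cuts in \<open>lb_value\<close> are constant, so minimizing the linear
  model minimizes the maximum.\<close>

lemma lb_opt_exists:
  assumes wf: "wf_state P N s" and ne: "lb_feas P s \<noteq> {}"
  shows "\<exists>V z. lb_opt P s V z"
proof (cases "T_set s = {}")
  case True
  then show ?thesis
    using ne unfolding lb_opt_def by (metis ex_in_conv prod.exhaust)
next
  case T: False
  define Q where "Q = {y \<in> Y_int P. S_cuts_ok s y}"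
  define D where "D = {z. fst z \<in> X_set P \<and> snd z \<in> Q \<and> lin_constraints_ok P (incumbent s) z}"
  have lb_iff: "(\<eta>, z) \<in> lb_feas P s \<longleftrightarrow> z \<in> D \<and> lb_value P s z \<le> \<eta>" for \<eta> z
    using lb_feas_iff[OF wf T] by (simp add: D_def Q_def)
  have "finite (T_set s)"
    using wf by (metis finite_Un finite_lessThan wf_state_def)
  have "\<exists>z\<in>D. \<forall>z'\<in>D. lb_value P s z \<le> lb_value P s z'"
  proof (rule finite_fibres_attain_min)
    show "finite Q"
      using finite_Y_int by (simp add: Q_def)
    show "D \<noteq> {}"
      using ne lb_iff by fastforce
    show "snd ` D \<subseteq> Q"
      by (auto simp: D_def)
    fix w assume w: "w \<in> D"
    \<comment> \<open>LB-MILP is treated as the quadratic case with zero Hessian.\<close>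
    have "\<exists>z\<in>D. snd z = snd w \<and> (\<forall>z'\<in>D. snd z' = snd w \<longrightarrow>
        linz (obj P) (incumbent s) z + 1 / 2 * ((z - incumbent s) \<bullet> 0)
        \<le> linz (obj P) (incumbent s) z' + 1 / 2 * ((z' - incumbent s) \<bullet> 0))"
      unfolding D_def
      by (rule linearized_attains_min[OF polyhedron_X sym_psd_zero_map, where
            m = "obj P (incumbent s) + gJ s (best s) \<bullet> (snd w - ypt s (best s))"])
        (use w wf_linz_obj_ge[OF wf T] in \<open>auto simp: D_def\<close>)
    then obtain z where z: "z \<in> D" "snd z = snd w"
        "\<And>z'. z' \<in> D \<Longrightarrow> snd z' = snd w \<Longrightarrow> linz (obj P) (incumbent s) z \<le> linz (obj P) (incumbent s) z'"
      by auto
    have "lb_value P s z \<le> lb_value P s z'" if "z' \<in> D" "snd z' = snd w" for z'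
      unfolding lb_value_def using \<open>finite (T_set s)\<close> z(2) z(3)[OF that] that(2)
      by (intro Max.boundedI) (auto intro: Max_ge_iff[THEN iffD2])
    then show "\<exists>z\<in>D. \<forall>z'\<in>D. snd z' = snd w \<longrightarrow> lb_value P s z \<le> lb_value P s z'"
      using z(1) by blast
  qed
  then obtain z where z: "z \<in> D" "\<And>z'. z' \<in> D \<Longrightarrow> lb_value P s z \<le> lb_value P s z'"
    by blast
  have "fst (lb_value P s z, z) \<le> fst w" if "w \<in> lb_feas P s" for w
    using that lb_iff[of "fst w" "snd w"] z(2)[of "snd w"] by simp
  moreover have "(lb_value P s z, z) \<in> lb_feas P s"
    using z(1) lb_iff by simp
  ultimately have "is_arg_min fst (\<lambda>w. w \<in> lb_feas P s) (lb_value P s z, z)"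
    unfolding is_arg_min_linorder by blast
  then have "lb_opt P s (ereal (lb_value P s z)) z"
    using T by (simp add: lb_opt_def)
  then show ?thesis
    by blast
qed

text \<open>Multipliers give a solution of BR-MIQP once an incumbent exists; before that, attainment
  is the hypothesis \<open>br\<close>. LB-MILP covers the remaining cases.\<close>

lemma master_phase_exists:
  assumes wf: "wf_state P N s" and M: "sym_psd M"
    and br: "T_set s = {} \<Longrightarrow> br_called s \<Longrightarrow> br_feas P \<alpha> s \<noteq> {} \<Longrightarrow> \<exists>z. br_opt P \<alpha> M s z"
  shows "\<exists>s'. master_phase P \<alpha> M s s'"
proof (cases "br_called s \<and> br_feas P \<alpha> s \<noteq> {}")
  case True
  then obtain x y where "br_opt P \<alpha> M s (x, y)"
    using br br_opt_exists[OF wf _ _ M] by (metis surj_pair)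
  then show ?thesis
    using True master_phase.br by blast
next
  case False
  then have *: "\<not> br_called s \<or> br_feas P \<alpha> s = {}"
    by blast
  show ?thesis
  proof (cases "lb_feas P s = {}")
    case True
    then show ?thesis
      using * master_phase.lb_infeasible by blast
  next
    case False
    then obtain V x y where "lb_opt P s V (x, y)"
      using lb_opt_exists[OF wf] by (metis surj_pair)
    then show ?thesis
      using * master_phase.lb by blast
  qed
qed

text \<open>Solvability of the NLP and the constraint qualification serve the feasible branch. In
  the other branch FNLP has a feasible point because the bounds have not met.\<close>

lemma nlp_phase_exists:
  assumes wf: "wf_state P (iter s) s" and "LB s < UB s"
    and solvable: "\<And>y. y \<in> Y_int P \<Longrightarrow> nlp_feas P y \<noteq> {} \<Longrightarrow> \<exists>x. nlp_opt P y x"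
    and mfcq: "\<And>y x. y \<in> Y_int P \<Longrightarrow> nlp_opt P y x \<Longrightarrow> mfcq P y x"
    and fnlp: "nlp_feas P (cur_y s) = {} \<Longrightarrow> fnlp_feas P (cur_y s) (feasible_best_y s) \<noteq> {} \<Longrightarrow>
      \<exists>z. fnlp_opt P (cur_y s) (feasible_best_y s) z"
  shows "\<exists>s1. nlp_phase P s s1"
proof (cases "nlp_feas P (cur_y s) = {}")
  case True
  then obtain x yb where "fnlp_opt P (cur_y s) (feasible_best_y s) (x, yb)"
    using fnlp fnlp_feas_nonempty[OF wf assms(2)] by (metis surj_pair)
  then show ?thesis
    using nlp_phase.infeasible[OF True] by blast
next
  case False
  have Y: "cur_y s \<in> Y_int P"
    using wf by (auto simp: wf_state_def)
  then obtain x where x: "nlp_opt P (cur_y s) x"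
    using solvable False by blast
  then obtain v where "is_gradJ P (cur_y s) x v"
    using is_gradJ_exists mfcq[OF Y] by blast
  then show ?thesis
    using nlp_phase.feasible[OF x] by blast
qed

end

theorem theorem1:
  fixes P :: "('nx::finite, 'ny::finite) minlp"
    and \<alpha> :: real
    and B :: "('nx, 'ny) state \<Rightarrow> (real ^ 'nx) \<times> (real ^ 'ny) \<Rightarrow> (real ^ 'nx) \<times> (real ^ 'ny)"
  assumes "polyhedron (X_set P)" and "polyhedron (Y_bar P)"
    and "twice_cont_differentiable (obj P)"
    and "\<And>i. i < n_g P \<Longrightarrow> twice_cont_differentiable (con_g P i)"
    and "\<And>j. j < n_h P \<Longrightarrow> twice_cont_differentiable (con_h P j)"
    and "finite (Y_int P)"
    and nlp_solvable: "\<And>y. y \<in> Y_int P \<Longrightarrow> nlp_feas P y \<noteq> {} \<Longrightarrow> \<exists>x. nlp_opt P y x"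
    and nlp_mfcq: "\<And>y x. y \<in> Y_int P \<Longrightarrow> nlp_opt P y x \<Longrightarrow> mfcq P y x"
    and "\<And>j. j < n_h P \<Longrightarrow> affine_fun (con_h P j)"
    and "\<And>i. i < n_g P \<Longrightarrow> convex_on (X_set P \<times> Y_bar P) (con_g P i)"
    and "convex_on (X_set P \<times> Y_bar P) (obj P)"
    and "0 \<le> \<alpha>" and "\<alpha> < 1"
    and "\<And>s. sym_psd (B s)"
    and fnlp_solvable: "\<And>s. reachable P \<alpha> B s \<Longrightarrow> LB s < UB s \<Longrightarrow> nlp_feas P (cur_y s) = {} \<Longrightarrow>
           fnlp_feas P (cur_y s) (feasible_best_y s) \<noteq> {} \<Longrightarrow>
           \<exists>z. fnlp_opt P (cur_y s) (feasible_best_y s) z"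
    and br_solvable: "\<And>s s1. reachable P \<alpha> B s \<Longrightarrow> LB s < UB s \<Longrightarrow> nlp_phase P s s1 \<Longrightarrow>
           T_set s1 = {} \<Longrightarrow> br_called s1 \<Longrightarrow> br_feas P \<alpha> s1 \<noteq> {} \<Longrightarrow>
           \<exists>z. br_opt P \<alpha> (B s1) s1 z"
  shows "(\<nexists>\<sigma>. initial_state P (\<sigma> 0) \<and> (\<forall>n. sbmiqp_step P \<alpha> B (\<sigma> n) (\<sigma> (Suc n)))) \<and>
         (\<forall>s. reachable P \<alpha> B s \<and> LB s < UB s \<longrightarrow> (\<exists>s'. sbmiqp_step P \<alpha> B s s')) \<and>
         (\<forall>s. reachable P \<alpha> B s \<and> \<not> LB s < UB s \<longrightarrow>
              returns_global_optimum P s \<or> returns_infeasibility_certificate P s)"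
proof -
  interpret convex_minlp P
    by unfold_locales (fact assms)+
  have wf: "wf_state P (iter s) s" if "reachable P \<alpha> B s" for s
    using reachable_wf that \<open>0 \<le> \<alpha>\<close> \<open>\<alpha> < 1\<close> by blast
  \<comment> \<open>Termination has two halves: no run is infinite, and no run gets stuck before the
    bounds meet.\<close>
  have "\<nexists>\<sigma>. initial_state P (\<sigma> 0) \<and> (\<forall>n. sbmiqp_step P \<alpha> B (\<sigma> n) (\<sigma> (Suc n)))"
    using no_infinite_run[OF \<open>0 \<le> \<alpha>\<close> \<open>\<alpha> < 1\<close>] by blast
  moreover have "\<exists>s'. sbmiqp_step P \<alpha> B s s'" if s: "reachable P \<alpha> B s" "LB s < UB s" for s
  proof -
    obtain s1 where s1: "nlp_phase P s s1"
      using nlp_phase_exists[OF wf[OF s(1)] s(2) nlp_solvable nlp_mfcq fnlp_solvable[OF s]] by blast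
    obtain s' where "master_phase P \<alpha> (B s1) s1 s'"
      using master_phase_exists[OF nlp_phase_wf[OF s1 wf[OF s(1)]] assms(14) br_solvable[OF s s1]]
      by blast
    then show ?thesis
      using s1 s(2) unfolding sbmiqp_step_def by blast
  qed
  moreover have "returns_global_optimum P s \<or> returns_infeasibility_certificate P s"
    if "reachable P \<alpha> B s" "\<not> LB s < UB s" for s
    using terminal_correct[OF wf[OF that(1)] that(2)] .
  ultimately show ?thesis
    by blast
qed

end
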